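(* For any type $A:\mathcal U$, the following are logically equivalent: (1) for every $\alpha:\mathbb N\to 2$, $\Big(\prod_{n:\mathbb N}\big\lVert(\alpha_n=1)\to A\big\rVert\Big)\to\Big\lVert\prod_{n:\mathbb N}\big((\alpha_n=1)\to A\big)\Big\rVert$; (2) for every proposition $P:\mathcal U$ with $\operatorname{isRosolini}(P)$, $\big(P\to\lVert A\rVert\big)\to\lVert P\to A\rVert$.
   Context: Type theory: Martin-Löf type theory with universe $\mathcal U$, function extensionality, proposition extensionality and propositional truncations $\lVert X\rVert$. For $\alpha:\mathbb N\to 2$ let $\langle\alpha\rangle:=\sum_{n:\mathbb N}(\alpha_n=1)$; $\mathbb N_\infty:=\sum_{\alpha:\mathbb N\to2}\operatorname{isProp}(\langle\alpha\rangle)$. A type $P$ is Rosolini, $\operatorname{isRosolini}(P)$, if $\big\lVert\sum_{u:\mathbb N_\infty}(P=\langle u\rangle)\big\rVert$. *)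

theory Defs
  imports Main
begin

text \<open>
  The statement concerns intensional Martin-Loef type theory and has no content when read in
  classical HOL, so the type theory itself is formalised, with de Bruijn indices, as an inductively
  generated derivability relation. The presentation is the usual one with contexts, typing
  and judgemental equality, and a cumulative hierarchy of Russell universes, any one of which can
  play the role of the universe of the statement; every type is an
  element of some universe.
\<close>

subsection \<open>Raw syntax\<close>

text \<open>
  Binding: the second argument of \<open>PiT\<close>, \<open>SigT\<close> and \<open>Lam\<close> binds one variable. The first argument
  of an induction operator is its motive, which binds one variable (two for \<open>J\<close>: the end point,
  index 1, and the path, index 0). The branches of \<open>SumInd\<close> bind one variable; the successor branch
  of \<open>NatInd\<close> binds two: the predecessor, index 1, and the inductive hypothesis, index 0.
\<close>

datatype tm =
    Var nat
  | Univ nat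
  | PiT tm tm | Lam tm tm | App tm tm
  | SigT tm tm | MkPair tm tm | Fst tm | Snd tm
  | EmptyT | EmptyInd tm tm
  | UnitT | Star | UnitInd tm tm tm
  | SumT tm tm | InL tm | InR tm | SumInd tm tm tm tm
  | TwoT | Two0 | Two1 | TwoInd tm tm tm tm
  | NatT | Zero | Succ tm | NatInd tm tm tm tm
  | IdT tm tm tm | Refl tm | J tm tm tm
  | Trunc tm | TrIn tm | TrEq tm tm | TrRec tm tm tm
  | FunExt tm tm tm
  | PropExt tm tm tm tm

definition scons :: "'a \<Rightarrow> (nat \<Rightarrow> 'a) \<Rightarrow> nat \<Rightarrow> 'a" (infixr "\<bullet>" 65) where
  "a \<bullet> \<sigma> = (\<lambda>n. case n of 0 \<Rightarrow> a | Suc m \<Rightarrow> \<sigma> m)"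

definition upr :: "(nat \<Rightarrow> nat) \<Rightarrow> nat \<Rightarrow> nat" where
  "upr \<rho> = 0 \<bullet> (\<lambda>n. Suc (\<rho> n))"

primrec ren :: "(nat \<Rightarrow> nat) \<Rightarrow> tm \<Rightarrow> tm" where
  "ren \<rho> (Var n) = Var (\<rho> n)"
| "ren \<rho> (Univ i) = Univ i"
| "ren \<rho> (PiT A B) = PiT (ren \<rho> A) (ren (upr \<rho>) B)"
| "ren \<rho> (Lam A b) = Lam (ren \<rho> A) (ren (upr \<rho>) b)"
| "ren \<rho> (App f a) = App (ren \<rho> f) (ren \<rho> a)"
| "ren \<rho> (SigT A B) = SigT (ren \<rho> A) (ren (upr \<rho>) B)"
| "ren \<rho> (MkPair a b) = MkPair (ren \<rho> a) (ren \<rho> b)"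
| "ren \<rho> (Fst p) = Fst (ren \<rho> p)"
| "ren \<rho> (Snd p) = Snd (ren \<rho> p)"
| "ren \<rho> EmptyT = EmptyT"
| "ren \<rho> (EmptyInd C e) = EmptyInd (ren (upr \<rho>) C) (ren \<rho> e)"
| "ren \<rho> UnitT = UnitT"
| "ren \<rho> Star = Star"
| "ren \<rho> (UnitInd C c u) = UnitInd (ren (upr \<rho>) C) (ren \<rho> c) (ren \<rho> u)"
| "ren \<rho> (SumT A B) = SumT (ren \<rho> A) (ren \<rho> B)"
| "ren \<rho> (InL a) = InL (ren \<rho> a)"
| "ren \<rho> (InR b) = InR (ren \<rho> b)"
| "ren \<rho> (SumInd C l r s) = SumInd (ren (upr \<rho>) C) (ren (upr \<rho>) l) (ren (upr \<rho>) r) (ren \<rho> s)"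
| "ren \<rho> TwoT = TwoT"
| "ren \<rho> Two0 = Two0"
| "ren \<rho> Two1 = Two1"
| "ren \<rho> (TwoInd C c d b) = TwoInd (ren (upr \<rho>) C) (ren \<rho> c) (ren \<rho> d) (ren \<rho> b)"
| "ren \<rho> NatT = NatT"
| "ren \<rho> Zero = Zero"
| "ren \<rho> (Succ n) = Succ (ren \<rho> n)"
| "ren \<rho> (NatInd C z s n) = NatInd (ren (upr \<rho>) C) (ren \<rho> z) (ren (upr (upr \<rho>)) s) (ren \<rho> n)"
| "ren \<rho> (IdT A a b) = IdT (ren \<rho> A) (ren \<rho> a) (ren \<rho> b)"
| "ren \<rho> (Refl a) = Refl (ren \<rho> a)"
| "ren \<rho> (J C d p) = J (ren (upr (upr \<rho>)) C) (ren \<rho> d) (ren \<rho> p)"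
| "ren \<rho> (Trunc A) = Trunc (ren \<rho> A)"
| "ren \<rho> (TrIn a) = TrIn (ren \<rho> a)"
| "ren \<rho> (TrEq x y) = TrEq (ren \<rho> x) (ren \<rho> y)"
| "ren \<rho> (TrRec h f x) = TrRec (ren \<rho> h) (ren \<rho> f) (ren \<rho> x)"
| "ren \<rho> (FunExt f g h) = FunExt (ren \<rho> f) (ren \<rho> g) (ren \<rho> h)"
| "ren \<rho> (PropExt p q f g) = PropExt (ren \<rho> p) (ren \<rho> q) (ren \<rho> f) (ren \<rho> g)"

abbreviation wk :: "tm \<Rightarrow> tm" where
  "wk \<equiv> ren Suc"

definition ups :: "(nat \<Rightarrow> tm) \<Rightarrow> nat \<Rightarrow> tm" where
  "ups \<sigma> = Var 0 \<bullet> (\<lambda>n. wk (\<sigma> n))"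

primrec sub :: "(nat \<Rightarrow> tm) \<Rightarrow> tm \<Rightarrow> tm" where
  "sub \<sigma> (Var n) = \<sigma> n"
| "sub \<sigma> (Univ i) = Univ i"
| "sub \<sigma> (PiT A B) = PiT (sub \<sigma> A) (sub (ups \<sigma>) B)"
| "sub \<sigma> (Lam A b) = Lam (sub \<sigma> A) (sub (ups \<sigma>) b)"
| "sub \<sigma> (App f a) = App (sub \<sigma> f) (sub \<sigma> a)"
| "sub \<sigma> (SigT A B) = SigT (sub \<sigma> A) (sub (ups \<sigma>) B)"
| "sub \<sigma> (MkPair a b) = MkPair (sub \<sigma> a) (sub \<sigma> b)"
| "sub \<sigma> (Fst p) = Fst (sub \<sigma> p)"
| "sub \<sigma> (Snd p) = Snd (sub \<sigma> p)"
| "sub \<sigma> EmptyT = EmptyT"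
| "sub \<sigma> (EmptyInd C e) = EmptyInd (sub (ups \<sigma>) C) (sub \<sigma> e)"
| "sub \<sigma> UnitT = UnitT"
| "sub \<sigma> Star = Star"
| "sub \<sigma> (UnitInd C c u) = UnitInd (sub (ups \<sigma>) C) (sub \<sigma> c) (sub \<sigma> u)"
| "sub \<sigma> (SumT A B) = SumT (sub \<sigma> A) (sub \<sigma> B)"
| "sub \<sigma> (InL a) = InL (sub \<sigma> a)"
| "sub \<sigma> (InR b) = InR (sub \<sigma> b)"
| "sub \<sigma> (SumInd C l r s) = SumInd (sub (ups \<sigma>) C) (sub (ups \<sigma>) l) (sub (ups \<sigma>) r) (sub \<sigma> s)"
| "sub \<sigma> TwoT = TwoT"
| "sub \<sigma> Two0 = Two0"
| "sub \<sigma> Two1 = Two1"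
| "sub \<sigma> (TwoInd C c d b) = TwoInd (sub (ups \<sigma>) C) (sub \<sigma> c) (sub \<sigma> d) (sub \<sigma> b)"
| "sub \<sigma> NatT = NatT"
| "sub \<sigma> Zero = Zero"
| "sub \<sigma> (Succ n) = Succ (sub \<sigma> n)"
| "sub \<sigma> (NatInd C z s n) = NatInd (sub (ups \<sigma>) C) (sub \<sigma> z) (sub (ups (ups \<sigma>)) s) (sub \<sigma> n)"
| "sub \<sigma> (IdT A a b) = IdT (sub \<sigma> A) (sub \<sigma> a) (sub \<sigma> b)"
| "sub \<sigma> (Refl a) = Refl (sub \<sigma> a)"
| "sub \<sigma> (J C d p) = J (sub (ups (ups \<sigma>)) C) (sub \<sigma> d) (sub \<sigma> p)"
| "sub \<sigma> (Trunc A) = Trunc (sub \<sigma> A)"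
| "sub \<sigma> (TrIn a) = TrIn (sub \<sigma> a)"
| "sub \<sigma> (TrEq x y) = TrEq (sub \<sigma> x) (sub \<sigma> y)"
| "sub \<sigma> (TrRec h f x) = TrRec (sub \<sigma> h) (sub \<sigma> f) (sub \<sigma> x)"
| "sub \<sigma> (FunExt f g h) = FunExt (sub \<sigma> f) (sub \<sigma> g) (sub \<sigma> h)"
| "sub \<sigma> (PropExt p q f g) = PropExt (sub \<sigma> p) (sub \<sigma> q) (sub \<sigma> f) (sub \<sigma> g)"

abbreviation inst1 :: "tm \<Rightarrow> tm \<Rightarrow> tm" where
  "inst1 B a \<equiv> sub (a \<bullet> Var) B"

text \<open>\<open>inst2 C a b\<close> puts \<open>a\<close> for index 1 and \<open>b\<close> for index 0.\<close>

abbreviation inst2 :: "tm \<Rightarrow> tm \<Rightarrow> tm \<Rightarrow> tm" where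
  "inst2 C a b \<equiv> sub (b \<bullet> a \<bullet> Var) C"

subsection \<open>Derived type formers\<close>

definition Arr :: "tm \<Rightarrow> tm \<Rightarrow> tm" (infixr "\<rightarrow>\<^sub>t" 60) where
  "A \<rightarrow>\<^sub>t B = PiT A (wk B)"

definition Times :: "tm \<Rightarrow> tm \<Rightarrow> tm" (infixr "\<times>\<^sub>t" 65) where
  "A \<times>\<^sub>t B = SigT A (wk B)"

definition Iff :: "tm \<Rightarrow> tm \<Rightarrow> tm" (infix "\<leftrightarrow>\<^sub>t" 58) where
  "A \<leftrightarrow>\<^sub>t B = (A \<rightarrow>\<^sub>t B) \<times>\<^sub>t (B \<rightarrow>\<^sub>t A)"

definition isProp :: "tm \<Rightarrow> tm" where
  "isProp A = PiT A (PiT (wk A) (IdT (wk (wk A)) (Var 1) (Var 0)))"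

subsection \<open>Judgements\<close>

text \<open>
  The head of a context is the type of the most recent variable. Congruence rules are named
  \<open>_C\<close>. Truncation comes with no judgemental computation rule: as its recursion principle
  only targets propositions, the computation rule holds up to \<open>IdT\<close> automatically.
\<close>

inductive
  ctx :: "tm list \<Rightarrow> bool" ("\<turnstile> _" [50] 50) and
  has :: "tm list \<Rightarrow> tm \<Rightarrow> tm \<Rightarrow> bool" ("_ \<turnstile> _ \<Colon> _" [50, 50, 50] 50) and
  jeq :: "tm list \<Rightarrow> tm \<Rightarrow> tm \<Rightarrow> tm \<Rightarrow> bool" ("_ \<turnstile> _ \<doteq> _ \<Colon> _" [50, 50, 50, 50] 50)
where
  ctx_Nil: "\<turnstile> []"
| ctx_Cons: "\<turnstile> \<Gamma> \<Longrightarrow> \<Gamma> \<turnstile> A \<Colon> Univ i \<Longrightarrow> \<turnstile> A # \<Gamma>"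
| Var: "\<turnstile> \<Gamma> \<Longrightarrow> n < length \<Gamma> \<Longrightarrow> \<Gamma> \<turnstile> Var n \<Colon> ren (\<lambda>k. k + Suc n) (\<Gamma> ! n)"

| Conv: "\<Gamma> \<turnstile> a \<Colon> A \<Longrightarrow> \<Gamma> \<turnstile> A \<doteq> B \<Colon> Univ i \<Longrightarrow> \<Gamma> \<turnstile> a \<Colon> B"
| Conv_eq: "\<Gamma> \<turnstile> a \<doteq> b \<Colon> A \<Longrightarrow> \<Gamma> \<turnstile> A \<doteq> B \<Colon> Univ i \<Longrightarrow> \<Gamma> \<turnstile> a \<doteq> b \<Colon> B"
| Eq_refl: "\<Gamma> \<turnstile> a \<Colon> A \<Longrightarrow> \<Gamma> \<turnstile> a \<doteq> a \<Colon> A"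
| Eq_sym: "\<Gamma> \<turnstile> a \<doteq> b \<Colon> A \<Longrightarrow> \<Gamma> \<turnstile> b \<doteq> a \<Colon> A"
| Eq_trans: "\<Gamma> \<turnstile> a \<doteq> b \<Colon> A \<Longrightarrow> \<Gamma> \<turnstile> b \<doteq> c \<Colon> A \<Longrightarrow> \<Gamma> \<turnstile> a \<doteq> c \<Colon> A"

| Univ_F: "\<turnstile> \<Gamma> \<Longrightarrow> \<Gamma> \<turnstile> Univ i \<Colon> Univ (Suc i)"
| Cumul: "\<Gamma> \<turnstile> A \<Colon> Univ i \<Longrightarrow> \<Gamma> \<turnstile> A \<Colon> Univ (Suc i)"
| Cumul_eq: "\<Gamma> \<turnstile> A \<doteq> B \<Colon> Univ i \<Longrightarrow> \<Gamma> \<turnstile> A \<doteq> B \<Colon> Univ (Suc i)"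

| Pi_F: "\<Gamma> \<turnstile> A \<Colon> Univ i \<Longrightarrow> A # \<Gamma> \<turnstile> B \<Colon> Univ i \<Longrightarrow> \<Gamma> \<turnstile> PiT A B \<Colon> Univ i"
| Pi_F_C: "\<Gamma> \<turnstile> A \<Colon> Univ i \<Longrightarrow> \<Gamma> \<turnstile> A \<doteq> A' \<Colon> Univ i \<Longrightarrow> A # \<Gamma> \<turnstile> B \<doteq> B' \<Colon> Univ i
    \<Longrightarrow> \<Gamma> \<turnstile> PiT A B \<doteq> PiT A' B' \<Colon> Univ i"
| Pi_I: "\<Gamma> \<turnstile> A \<Colon> Univ i \<Longrightarrow> A # \<Gamma> \<turnstile> b \<Colon> B \<Longrightarrow> \<Gamma> \<turnstile> Lam A b \<Colon> PiT A B"
| Pi_I_C: "\<Gamma> \<turnstile> A \<Colon> Univ i \<Longrightarrow> \<Gamma> \<turnstile> A \<doteq> A' \<Colon> Univ i \<Longrightarrow> A # \<Gamma> \<turnstile> b \<doteq> b' \<Colon> B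
    \<Longrightarrow> \<Gamma> \<turnstile> Lam A b \<doteq> Lam A' b' \<Colon> PiT A B"
| Pi_E: "\<Gamma> \<turnstile> f \<Colon> PiT A B \<Longrightarrow> \<Gamma> \<turnstile> a \<Colon> A \<Longrightarrow> \<Gamma> \<turnstile> App f a \<Colon> inst1 B a"
| Pi_E_C: "\<Gamma> \<turnstile> f \<doteq> f' \<Colon> PiT A B \<Longrightarrow> \<Gamma> \<turnstile> a \<doteq> a' \<Colon> A \<Longrightarrow> \<Gamma> \<turnstile> App f a \<doteq> App f' a' \<Colon> inst1 B a"
| Pi_beta: "\<Gamma> \<turnstile> A \<Colon> Univ i \<Longrightarrow> A # \<Gamma> \<turnstile> b \<Colon> B \<Longrightarrow> \<Gamma> \<turnstile> a \<Colon> A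
    \<Longrightarrow> \<Gamma> \<turnstile> App (Lam A b) a \<doteq> inst1 b a \<Colon> inst1 B a"
| Pi_eta: "\<Gamma> \<turnstile> f \<Colon> PiT A B \<Longrightarrow> \<Gamma> \<turnstile> f \<doteq> Lam A (App (wk f) (Var 0)) \<Colon> PiT A B"

| Sig_F: "\<Gamma> \<turnstile> A \<Colon> Univ i \<Longrightarrow> A # \<Gamma> \<turnstile> B \<Colon> Univ i \<Longrightarrow> \<Gamma> \<turnstile> SigT A B \<Colon> Univ i"
| Sig_F_C: "\<Gamma> \<turnstile> A \<Colon> Univ i \<Longrightarrow> \<Gamma> \<turnstile> A \<doteq> A' \<Colon> Univ i \<Longrightarrow> A # \<Gamma> \<turnstile> B \<doteq> B' \<Colon> Univ i
    \<Longrightarrow> \<Gamma> \<turnstile> SigT A B \<doteq> SigT A' B' \<Colon> Univ i"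
| Sig_I: "A # \<Gamma> \<turnstile> B \<Colon> Univ i \<Longrightarrow> \<Gamma> \<turnstile> a \<Colon> A \<Longrightarrow> \<Gamma> \<turnstile> b \<Colon> inst1 B a \<Longrightarrow> \<Gamma> \<turnstile> MkPair a b \<Colon> SigT A B"
| Sig_I_C: "A # \<Gamma> \<turnstile> B \<Colon> Univ i \<Longrightarrow> \<Gamma> \<turnstile> a \<doteq> a' \<Colon> A \<Longrightarrow> \<Gamma> \<turnstile> b \<doteq> b' \<Colon> inst1 B a
    \<Longrightarrow> \<Gamma> \<turnstile> MkPair a b \<doteq> MkPair a' b' \<Colon> SigT A B"
| Fst_E: "\<Gamma> \<turnstile> p \<Colon> SigT A B \<Longrightarrow> \<Gamma> \<turnstile> Fst p \<Colon> A"
| Fst_E_C: "\<Gamma> \<turnstile> p \<doteq> p' \<Colon> SigT A B \<Longrightarrow> \<Gamma> \<turnstile> Fst p \<doteq> Fst p' \<Colon> A"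
| Snd_E: "\<Gamma> \<turnstile> p \<Colon> SigT A B \<Longrightarrow> \<Gamma> \<turnstile> Snd p \<Colon> inst1 B (Fst p)"
| Snd_E_C: "\<Gamma> \<turnstile> p \<doteq> p' \<Colon> SigT A B \<Longrightarrow> \<Gamma> \<turnstile> Snd p \<doteq> Snd p' \<Colon> inst1 B (Fst p)"
| Fst_beta: "A # \<Gamma> \<turnstile> B \<Colon> Univ i \<Longrightarrow> \<Gamma> \<turnstile> a \<Colon> A \<Longrightarrow> \<Gamma> \<turnstile> b \<Colon> inst1 B a
    \<Longrightarrow> \<Gamma> \<turnstile> Fst (MkPair a b) \<doteq> a \<Colon> A"
| Snd_beta: "A # \<Gamma> \<turnstile> B \<Colon> Univ i \<Longrightarrow> \<Gamma> \<turnstile> a \<Colon> A \<Longrightarrow> \<Gamma> \<turnstile> b \<Colon> inst1 B a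
    \<Longrightarrow> \<Gamma> \<turnstile> Snd (MkPair a b) \<doteq> b \<Colon> inst1 B a"
| Sig_eta: "\<Gamma> \<turnstile> p \<Colon> SigT A B \<Longrightarrow> \<Gamma> \<turnstile> p \<doteq> MkPair (Fst p) (Snd p) \<Colon> SigT A B"

| Empty_F: "\<turnstile> \<Gamma> \<Longrightarrow> \<Gamma> \<turnstile> EmptyT \<Colon> Univ i"
| Empty_E: "EmptyT # \<Gamma> \<turnstile> C \<Colon> Univ i \<Longrightarrow> \<Gamma> \<turnstile> e \<Colon> EmptyT \<Longrightarrow> \<Gamma> \<turnstile> EmptyInd C e \<Colon> inst1 C e"
| Empty_E_C: "EmptyT # \<Gamma> \<turnstile> C \<doteq> C' \<Colon> Univ i \<Longrightarrow> \<Gamma> \<turnstile> e \<doteq> e' \<Colon> EmptyT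
    \<Longrightarrow> \<Gamma> \<turnstile> EmptyInd C e \<doteq> EmptyInd C' e' \<Colon> inst1 C e"

| Unit_F: "\<turnstile> \<Gamma> \<Longrightarrow> \<Gamma> \<turnstile> UnitT \<Colon> Univ i"
| Unit_I: "\<turnstile> \<Gamma> \<Longrightarrow> \<Gamma> \<turnstile> Star \<Colon> UnitT"
| Unit_E: "UnitT # \<Gamma> \<turnstile> C \<Colon> Univ i \<Longrightarrow> \<Gamma> \<turnstile> c \<Colon> inst1 C Star \<Longrightarrow> \<Gamma> \<turnstile> u \<Colon> UnitT
    \<Longrightarrow> \<Gamma> \<turnstile> UnitInd C c u \<Colon> inst1 C u"
| Unit_E_C: "UnitT # \<Gamma> \<turnstile> C \<doteq> C' \<Colon> Univ i \<Longrightarrow> \<Gamma> \<turnstile> c \<doteq> c' \<Colon> inst1 C Star \<Longrightarrow> \<Gamma> \<turnstile> u \<doteq> u' \<Colon> UnitT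
    \<Longrightarrow> \<Gamma> \<turnstile> UnitInd C c u \<doteq> UnitInd C' c' u' \<Colon> inst1 C u"
| Unit_beta: "UnitT # \<Gamma> \<turnstile> C \<Colon> Univ i \<Longrightarrow> \<Gamma> \<turnstile> c \<Colon> inst1 C Star
    \<Longrightarrow> \<Gamma> \<turnstile> UnitInd C c Star \<doteq> c \<Colon> inst1 C Star"

| Sum_F: "\<Gamma> \<turnstile> A \<Colon> Univ i \<Longrightarrow> \<Gamma> \<turnstile> B \<Colon> Univ i \<Longrightarrow> \<Gamma> \<turnstile> SumT A B \<Colon> Univ i"
| Sum_F_C: "\<Gamma> \<turnstile> A \<doteq> A' \<Colon> Univ i \<Longrightarrow> \<Gamma> \<turnstile> B \<doteq> B' \<Colon> Univ i \<Longrightarrow> \<Gamma> \<turnstile> SumT A B \<doteq> SumT A' B' \<Colon> Univ i"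
| InL_I: "\<Gamma> \<turnstile> B \<Colon> Univ i \<Longrightarrow> \<Gamma> \<turnstile> a \<Colon> A \<Longrightarrow> \<Gamma> \<turnstile> InL a \<Colon> SumT A B"
| InL_I_C: "\<Gamma> \<turnstile> B \<Colon> Univ i \<Longrightarrow> \<Gamma> \<turnstile> a \<doteq> a' \<Colon> A \<Longrightarrow> \<Gamma> \<turnstile> InL a \<doteq> InL a' \<Colon> SumT A B"
| InR_I: "\<Gamma> \<turnstile> A \<Colon> Univ i \<Longrightarrow> \<Gamma> \<turnstile> b \<Colon> B \<Longrightarrow> \<Gamma> \<turnstile> InR b \<Colon> SumT A B"
| InR_I_C: "\<Gamma> \<turnstile> A \<Colon> Univ i \<Longrightarrow> \<Gamma> \<turnstile> b \<doteq> b' \<Colon> B \<Longrightarrow> \<Gamma> \<turnstile> InR b \<doteq> InR b' \<Colon> SumT A B"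
| Sum_E: "SumT A B # \<Gamma> \<turnstile> C \<Colon> Univ i
    \<Longrightarrow> A # \<Gamma> \<turnstile> l \<Colon> sub (InL (Var 0) \<bullet> (\<lambda>k. Var (k + 1))) C
    \<Longrightarrow> B # \<Gamma> \<turnstile> r \<Colon> sub (InR (Var 0) \<bullet> (\<lambda>k. Var (k + 1))) C
    \<Longrightarrow> \<Gamma> \<turnstile> s \<Colon> SumT A B
    \<Longrightarrow> \<Gamma> \<turnstile> SumInd C l r s \<Colon> inst1 C s"
| Sum_E_C: "SumT A B # \<Gamma> \<turnstile> C \<doteq> C' \<Colon> Univ i
    \<Longrightarrow> A # \<Gamma> \<turnstile> l \<doteq> l' \<Colon> sub (InL (Var 0) \<bullet> (\<lambda>k. Var (k + 1))) C
    \<Longrightarrow> B # \<Gamma> \<turnstile> r \<doteq> r' \<Colon> sub (InR (Var 0) \<bullet> (\<lambda>k. Var (k + 1))) C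
    \<Longrightarrow> \<Gamma> \<turnstile> s \<doteq> s' \<Colon> SumT A B
    \<Longrightarrow> \<Gamma> \<turnstile> SumInd C l r s \<doteq> SumInd C' l' r' s' \<Colon> inst1 C s"
| InL_beta: "SumT A B # \<Gamma> \<turnstile> C \<Colon> Univ i
    \<Longrightarrow> A # \<Gamma> \<turnstile> l \<Colon> sub (InL (Var 0) \<bullet> (\<lambda>k. Var (k + 1))) C
    \<Longrightarrow> B # \<Gamma> \<turnstile> r \<Colon> sub (InR (Var 0) \<bullet> (\<lambda>k. Var (k + 1))) C
    \<Longrightarrow> \<Gamma> \<turnstile> a \<Colon> A
    \<Longrightarrow> \<Gamma> \<turnstile> SumInd C l r (InL a) \<doteq> inst1 l a \<Colon> inst1 C (InL a)"
| InR_beta: "SumT A B # \<Gamma> \<turnstile> C \<Colon> Univ i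
    \<Longrightarrow> A # \<Gamma> \<turnstile> l \<Colon> sub (InL (Var 0) \<bullet> (\<lambda>k. Var (k + 1))) C
    \<Longrightarrow> B # \<Gamma> \<turnstile> r \<Colon> sub (InR (Var 0) \<bullet> (\<lambda>k. Var (k + 1))) C
    \<Longrightarrow> \<Gamma> \<turnstile> b \<Colon> B
    \<Longrightarrow> \<Gamma> \<turnstile> SumInd C l r (InR b) \<doteq> inst1 r b \<Colon> inst1 C (InR b)"

| Two_F: "\<turnstile> \<Gamma> \<Longrightarrow> \<Gamma> \<turnstile> TwoT \<Colon> Univ i"
| Two0_I: "\<turnstile> \<Gamma> \<Longrightarrow> \<Gamma> \<turnstile> Two0 \<Colon> TwoT"
| Two1_I: "\<turnstile> \<Gamma> \<Longrightarrow> \<Gamma> \<turnstile> Two1 \<Colon> TwoT"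
| Two_E: "TwoT # \<Gamma> \<turnstile> C \<Colon> Univ i \<Longrightarrow> \<Gamma> \<turnstile> c \<Colon> inst1 C Two0 \<Longrightarrow> \<Gamma> \<turnstile> d \<Colon> inst1 C Two1 \<Longrightarrow> \<Gamma> \<turnstile> b \<Colon> TwoT
    \<Longrightarrow> \<Gamma> \<turnstile> TwoInd C c d b \<Colon> inst1 C b"
| Two_E_C: "TwoT # \<Gamma> \<turnstile> C \<doteq> C' \<Colon> Univ i \<Longrightarrow> \<Gamma> \<turnstile> c \<doteq> c' \<Colon> inst1 C Two0
    \<Longrightarrow> \<Gamma> \<turnstile> d \<doteq> d' \<Colon> inst1 C Two1 \<Longrightarrow> \<Gamma> \<turnstile> b \<doteq> b' \<Colon> TwoT
    \<Longrightarrow> \<Gamma> \<turnstile> TwoInd C c d b \<doteq> TwoInd C' c' d' b' \<Colon> inst1 C b"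
| Two0_beta: "TwoT # \<Gamma> \<turnstile> C \<Colon> Univ i \<Longrightarrow> \<Gamma> \<turnstile> c \<Colon> inst1 C Two0 \<Longrightarrow> \<Gamma> \<turnstile> d \<Colon> inst1 C Two1
    \<Longrightarrow> \<Gamma> \<turnstile> TwoInd C c d Two0 \<doteq> c \<Colon> inst1 C Two0"
| Two1_beta: "TwoT # \<Gamma> \<turnstile> C \<Colon> Univ i \<Longrightarrow> \<Gamma> \<turnstile> c \<Colon> inst1 C Two0 \<Longrightarrow> \<Gamma> \<turnstile> d \<Colon> inst1 C Two1
    \<Longrightarrow> \<Gamma> \<turnstile> TwoInd C c d Two1 \<doteq> d \<Colon> inst1 C Two1"

| Nat_F: "\<turnstile> \<Gamma> \<Longrightarrow> \<Gamma> \<turnstile> NatT \<Colon> Univ i"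
| Zero_I: "\<turnstile> \<Gamma> \<Longrightarrow> \<Gamma> \<turnstile> Zero \<Colon> NatT"
| Succ_I: "\<Gamma> \<turnstile> n \<Colon> NatT \<Longrightarrow> \<Gamma> \<turnstile> Succ n \<Colon> NatT"
| Succ_I_C: "\<Gamma> \<turnstile> n \<doteq> n' \<Colon> NatT \<Longrightarrow> \<Gamma> \<turnstile> Succ n \<doteq> Succ n' \<Colon> NatT"
| Nat_E: "NatT # \<Gamma> \<turnstile> C \<Colon> Univ i \<Longrightarrow> \<Gamma> \<turnstile> z \<Colon> inst1 C Zero
    \<Longrightarrow> C # NatT # \<Gamma> \<turnstile> s \<Colon> sub (Succ (Var 1) \<bullet> (\<lambda>k. Var (k + 2))) C \<Longrightarrow> \<Gamma> \<turnstile> n \<Colon> NatT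
    \<Longrightarrow> \<Gamma> \<turnstile> NatInd C z s n \<Colon> inst1 C n"
| Nat_E_C: "NatT # \<Gamma> \<turnstile> C \<Colon> Univ i \<Longrightarrow> NatT # \<Gamma> \<turnstile> C \<doteq> C' \<Colon> Univ i \<Longrightarrow> \<Gamma> \<turnstile> z \<doteq> z' \<Colon> inst1 C Zero
    \<Longrightarrow> C # NatT # \<Gamma> \<turnstile> s \<doteq> s' \<Colon> sub (Succ (Var 1) \<bullet> (\<lambda>k. Var (k + 2))) C \<Longrightarrow> \<Gamma> \<turnstile> n \<doteq> n' \<Colon> NatT
    \<Longrightarrow> \<Gamma> \<turnstile> NatInd C z s n \<doteq> NatInd C' z' s' n' \<Colon> inst1 C n"
| Zero_beta: "NatT # \<Gamma> \<turnstile> C \<Colon> Univ i \<Longrightarrow> \<Gamma> \<turnstile> z \<Colon> inst1 C Zero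
    \<Longrightarrow> C # NatT # \<Gamma> \<turnstile> s \<Colon> sub (Succ (Var 1) \<bullet> (\<lambda>k. Var (k + 2))) C
    \<Longrightarrow> \<Gamma> \<turnstile> NatInd C z s Zero \<doteq> z \<Colon> inst1 C Zero"
| Succ_beta: "NatT # \<Gamma> \<turnstile> C \<Colon> Univ i \<Longrightarrow> \<Gamma> \<turnstile> z \<Colon> inst1 C Zero
    \<Longrightarrow> C # NatT # \<Gamma> \<turnstile> s \<Colon> sub (Succ (Var 1) \<bullet> (\<lambda>k. Var (k + 2))) C \<Longrightarrow> \<Gamma> \<turnstile> n \<Colon> NatT
    \<Longrightarrow> \<Gamma> \<turnstile> NatInd C z s (Succ n) \<doteq> inst2 s n (NatInd C z s n) \<Colon> inst1 C (Succ n)"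

| Id_F: "\<Gamma> \<turnstile> A \<Colon> Univ i \<Longrightarrow> \<Gamma> \<turnstile> a \<Colon> A \<Longrightarrow> \<Gamma> \<turnstile> b \<Colon> A \<Longrightarrow> \<Gamma> \<turnstile> IdT A a b \<Colon> Univ i"
| Id_F_C: "\<Gamma> \<turnstile> A \<doteq> A' \<Colon> Univ i \<Longrightarrow> \<Gamma> \<turnstile> a \<doteq> a' \<Colon> A \<Longrightarrow> \<Gamma> \<turnstile> b \<doteq> b' \<Colon> A
    \<Longrightarrow> \<Gamma> \<turnstile> IdT A a b \<doteq> IdT A' a' b' \<Colon> Univ i"
| Id_I: "\<Gamma> \<turnstile> a \<Colon> A \<Longrightarrow> \<Gamma> \<turnstile> Refl a \<Colon> IdT A a a"
| Id_I_C: "\<Gamma> \<turnstile> a \<doteq> a' \<Colon> A \<Longrightarrow> \<Gamma> \<turnstile> Refl a \<doteq> Refl a' \<Colon> IdT A a a"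
| Id_E: "IdT (wk A) (wk a) (Var 0) # A # \<Gamma> \<turnstile> C \<Colon> Univ i \<Longrightarrow> \<Gamma> \<turnstile> a \<Colon> A \<Longrightarrow> \<Gamma> \<turnstile> d \<Colon> inst2 C a (Refl a)
    \<Longrightarrow> \<Gamma> \<turnstile> b \<Colon> A \<Longrightarrow> \<Gamma> \<turnstile> p \<Colon> IdT A a b
    \<Longrightarrow> \<Gamma> \<turnstile> J C d p \<Colon> inst2 C b p"
| Id_E_C: "IdT (wk A) (wk a) (Var 0) # A # \<Gamma> \<turnstile> C \<doteq> C' \<Colon> Univ i \<Longrightarrow> \<Gamma> \<turnstile> a \<Colon> A
    \<Longrightarrow> \<Gamma> \<turnstile> d \<doteq> d' \<Colon> inst2 C a (Refl a) \<Longrightarrow> \<Gamma> \<turnstile> b \<Colon> A \<Longrightarrow> \<Gamma> \<turnstile> p \<doteq> p' \<Colon> IdT A a b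
    \<Longrightarrow> \<Gamma> \<turnstile> J C d p \<doteq> J C' d' p' \<Colon> inst2 C b p"
| Id_beta: "IdT (wk A) (wk a) (Var 0) # A # \<Gamma> \<turnstile> C \<Colon> Univ i \<Longrightarrow> \<Gamma> \<turnstile> a \<Colon> A
    \<Longrightarrow> \<Gamma> \<turnstile> d \<Colon> inst2 C a (Refl a)
    \<Longrightarrow> \<Gamma> \<turnstile> J C d (Refl a) \<doteq> d \<Colon> inst2 C a (Refl a)"

| Trunc_F: "\<Gamma> \<turnstile> A \<Colon> Univ i \<Longrightarrow> \<Gamma> \<turnstile> Trunc A \<Colon> Univ i"
| Trunc_F_C: "\<Gamma> \<turnstile> A \<doteq> A' \<Colon> Univ i \<Longrightarrow> \<Gamma> \<turnstile> Trunc A \<doteq> Trunc A' \<Colon> Univ i"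
| Trunc_I: "\<Gamma> \<turnstile> a \<Colon> A \<Longrightarrow> \<Gamma> \<turnstile> TrIn a \<Colon> Trunc A"
| Trunc_I_C: "\<Gamma> \<turnstile> a \<doteq> a' \<Colon> A \<Longrightarrow> \<Gamma> \<turnstile> TrIn a \<doteq> TrIn a' \<Colon> Trunc A"
| Trunc_prop: "\<Gamma> \<turnstile> x \<Colon> Trunc A \<Longrightarrow> \<Gamma> \<turnstile> y \<Colon> Trunc A \<Longrightarrow> \<Gamma> \<turnstile> TrEq x y \<Colon> IdT (Trunc A) x y"
| Trunc_prop_C: "\<Gamma> \<turnstile> x \<doteq> x' \<Colon> Trunc A \<Longrightarrow> \<Gamma> \<turnstile> y \<doteq> y' \<Colon> Trunc A
    \<Longrightarrow> \<Gamma> \<turnstile> TrEq x y \<doteq> TrEq x' y' \<Colon> IdT (Trunc A) x y"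
| Trunc_E: "\<Gamma> \<turnstile> B \<Colon> Univ i \<Longrightarrow> \<Gamma> \<turnstile> h \<Colon> isProp B \<Longrightarrow> \<Gamma> \<turnstile> f \<Colon> A \<rightarrow>\<^sub>t B \<Longrightarrow> \<Gamma> \<turnstile> x \<Colon> Trunc A
    \<Longrightarrow> \<Gamma> \<turnstile> TrRec h f x \<Colon> B"
| Trunc_E_C: "\<Gamma> \<turnstile> B \<Colon> Univ i \<Longrightarrow> \<Gamma> \<turnstile> h \<doteq> h' \<Colon> isProp B \<Longrightarrow> \<Gamma> \<turnstile> f \<doteq> f' \<Colon> A \<rightarrow>\<^sub>t B
    \<Longrightarrow> \<Gamma> \<turnstile> x \<doteq> x' \<Colon> Trunc A \<Longrightarrow> \<Gamma> \<turnstile> TrRec h f x \<doteq> TrRec h' f' x' \<Colon> B"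

| FunExt: "\<Gamma> \<turnstile> f \<Colon> PiT A B \<Longrightarrow> \<Gamma> \<turnstile> g \<Colon> PiT A B
    \<Longrightarrow> \<Gamma> \<turnstile> h \<Colon> PiT A (IdT B (App (wk f) (Var 0)) (App (wk g) (Var 0)))
    \<Longrightarrow> \<Gamma> \<turnstile> FunExt f g h \<Colon> IdT (PiT A B) f g"
| FunExt_C: "\<Gamma> \<turnstile> f \<doteq> f' \<Colon> PiT A B \<Longrightarrow> \<Gamma> \<turnstile> g \<doteq> g' \<Colon> PiT A B
    \<Longrightarrow> \<Gamma> \<turnstile> h \<doteq> h' \<Colon> PiT A (IdT B (App (wk f) (Var 0)) (App (wk g) (Var 0)))
    \<Longrightarrow> \<Gamma> \<turnstile> FunExt f g h \<doteq> FunExt f' g' h' \<Colon> IdT (PiT A B) f g"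
| PropExt: "\<Gamma> \<turnstile> P \<Colon> Univ i \<Longrightarrow> \<Gamma> \<turnstile> Q \<Colon> Univ i \<Longrightarrow> \<Gamma> \<turnstile> p \<Colon> isProp P \<Longrightarrow> \<Gamma> \<turnstile> q \<Colon> isProp Q
    \<Longrightarrow> \<Gamma> \<turnstile> f \<Colon> P \<rightarrow>\<^sub>t Q \<Longrightarrow> \<Gamma> \<turnstile> g \<Colon> Q \<rightarrow>\<^sub>t P
    \<Longrightarrow> \<Gamma> \<turnstile> PropExt p q f g \<Colon> IdT (Univ i) P Q"
| PropExt_C: "\<Gamma> \<turnstile> P \<Colon> Univ i \<Longrightarrow> \<Gamma> \<turnstile> Q \<Colon> Univ i \<Longrightarrow> \<Gamma> \<turnstile> p \<doteq> p' \<Colon> isProp P \<Longrightarrow> \<Gamma> \<turnstile> q \<doteq> q' \<Colon> isProp Q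
    \<Longrightarrow> \<Gamma> \<turnstile> f \<doteq> f' \<Colon> P \<rightarrow>\<^sub>t Q \<Longrightarrow> \<Gamma> \<turnstile> g \<doteq> g' \<Colon> Q \<rightarrow>\<^sub>t P
    \<Longrightarrow> \<Gamma> \<turnstile> PropExt p q f g \<doteq> PropExt p' q' f' g' \<Colon> IdT (Univ i) P Q"

subsection \<open>Rosolini propositions and the two choice principles\<close>

text \<open>\<open>isOne \<alpha> n\<close> is the type \<open>\<alpha>\<^sub>n = 1\<close>, and \<open>angle \<alpha>\<close> is \<open>\<langle>\<alpha>\<rangle>\<close>.\<close>

definition isOne :: "tm \<Rightarrow> tm \<Rightarrow> tm" where
  "isOne \<alpha> n = IdT TwoT (App \<alpha> n) Two1"

definition angle :: "tm \<Rightarrow> tm" where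
  "angle \<alpha> = SigT NatT (isOne (wk \<alpha>) (Var 0))"

definition Ninf :: tm where
  "Ninf = SigT (NatT \<rightarrow>\<^sub>t TwoT) (isProp (angle (Var 0)))"

text \<open>For \<open>u : Ninf\<close>, the type \<open>\<langle>u\<rangle>\<close> is that of the underlying sequence.\<close>

definition isRosolini :: "nat \<Rightarrow> tm \<Rightarrow> tm" where
  "isRosolini i P = Trunc (SigT Ninf (IdT (Univ i) (wk P) (angle (Fst (Var 0)))))"

text \<open>Under the binders, \<open>\<alpha>\<close> is \<open>Var 1\<close> and \<open>n\<close> is \<open>Var 0\<close>.\<close>

definition sequence_choice :: "tm \<Rightarrow> tm" where
  "sequence_choice A =
    PiT (NatT \<rightarrow>\<^sub>t TwoT)
      (PiT NatT (Trunc (isOne (Var 1) (Var 0) \<rightarrow>\<^sub>t wk (wk A)))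
        \<rightarrow>\<^sub>t Trunc (PiT NatT (isOne (Var 1) (Var 0) \<rightarrow>\<^sub>t wk (wk A))))"

definition Rosolini_choice :: "nat \<Rightarrow> tm \<Rightarrow> tm" where
  "Rosolini_choice i A =
    PiT (Univ i)
      (isProp (Var 0) \<rightarrow>\<^sub>t isRosolini i (Var 0)
        \<rightarrow>\<^sub>t (Var 0 \<rightarrow>\<^sub>t Trunc (wk A)) \<rightarrow>\<^sub>t Trunc (Var 0 \<rightarrow>\<^sub>t wk A))"

end

theory Submission
  imports Defs
begin

text \<open>
  From (1) to (2): a Rosolini proposition equals some \<open>\<langle>\<alpha>\<rangle>\<close>, so by transport it suffices to
  treat \<open>\<langle>\<alpha>\<rangle>\<close>. A map \<open>\<langle>\<alpha>\<rangle> \<rightarrow> \<parallel>A\<parallel>\<close> is a family of maps \<open>(\<alpha>\<^sub>n = 1) \<rightarrow> \<parallel>A\<parallel>\<close>; as \<open>\<alpha>\<^sub>n = 1\<close> is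
  decidable the truncation moves outside, and (1) applies. From (2) to (1): let \<open>\<beta>\<^sub>n = 1\<close> hold exactly
  at the first \<open>n\<close> with \<open>\<alpha>\<^sub>n = 1\<close>. Then \<open>\<langle>\<beta>\<rangle>\<close> is a proposition, so (2) applies to it; \<open>\<beta>\<^sub>n = 1\<close>
  implies \<open>\<alpha>\<^sub>n = 1\<close>, which in turn implies \<open>\<langle>\<beta>\<rangle>\<close>.

  To argue inside the type theory without writing terms, stability of the judgements under
  substitution is used to turn the typing rules into natural deduction for the judgement \<open>\<Gamma> \<tturnstile> T\<close> that
  \<open>T\<close> is inhabited.
\<close>

section \<open>Renaming and substitution\<close>

lemma scons_simps [simp]:
  "(a \<bullet> \<sigma>) 0 = a" "(a \<bullet> \<sigma>) (Suc n) = \<sigma> n" "(a \<bullet> \<sigma>) (numeral k) = \<sigma> (pred_numeral k)"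
  by (simp_all add: scons_def numeral_eq_Suc)

lemma upr_simps [simp]:
  "upr \<rho> 0 = 0" "upr \<rho> (Suc n) = Suc (\<rho> n)" "upr \<rho> (numeral k) = Suc (\<rho> (pred_numeral k))"
  by (simp_all add: upr_def)

lemma ups_simps [simp]:
  "ups \<sigma> 0 = Var 0" "ups \<sigma> (Suc n) = wk (\<sigma> n)" "ups \<sigma> (numeral k) = wk (\<sigma> (pred_numeral k))"
  by (simp_all add: ups_def)

lemma upr_comp_upr: "upr \<rho> \<circ> upr \<rho>' = upr (\<rho> \<circ> \<rho>')"
  by (rule ext) (simp add: upr_def scons_def split: nat.split)

lemma ups_comp_upr: "ups \<sigma> \<circ> upr \<rho> = ups (\<sigma> \<circ> \<rho>)"
  by (rule ext) (simp add: ups_def upr_def scons_def split: nat.split)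

lemma ren_ren: "ren \<rho> (ren \<rho>' t) = ren (\<rho> \<circ> \<rho>') t"
  by (induction t arbitrary: \<rho> \<rho>') (simp_all add: upr_comp_upr)

lemma sub_ren: "sub \<sigma> (ren \<rho> t) = sub (\<sigma> \<circ> \<rho>) t"
  by (induction t arbitrary: \<sigma> \<rho>) (simp_all add: ups_comp_upr)

lemma ren_upr_wk [simp]: "ren (upr \<rho>) (wk t) = wk (ren \<rho> t)"
  by (simp add: ren_ren comp_def)

lemma ren_Arr [simp]: "ren \<rho> (A \<rightarrow>\<^sub>t B) = ren \<rho> A \<rightarrow>\<^sub>t ren \<rho> B"
  and ren_isProp [simp]: "ren \<rho> (isProp A) = isProp (ren \<rho> A)"
  by (simp_all add: Arr_def isProp_def)

lemma ren_upr_comp_ups: "ren (upr \<rho>) \<circ> ups \<sigma> = ups (ren \<rho> \<circ> \<sigma>)"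
proof
  show "(ren (upr \<rho>) \<circ> ups \<sigma>) n = ups (ren \<rho> \<circ> \<sigma>) n" for n
    by (cases n) simp_all
qed

lemma ren_sub: "ren \<rho> (sub \<sigma> t) = sub (ren \<rho> \<circ> \<sigma>) t"
  by (induction t arbitrary: \<sigma> \<rho>) (simp_all add: ren_upr_comp_ups)

lemma ups_Var [simp]: "ups Var = Var"
  by (rule ext) (simp add: ups_def scons_def split: nat.split)

lemma ups_Var_comp: "ups (Var \<circ> \<rho>) = Var \<circ> upr \<rho>"
  using ups_comp_upr[of Var \<rho>] by simp

lemma sub_Var [simp]: "sub Var t = t"
  by (induction t) simp_all

lemma sub_scons_wk [simp]: "sub (a \<bullet> \<sigma>) (wk t) = sub \<sigma> t"
  by (simp add: sub_ren comp_def)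

lemma sub_ups_wk [simp]: "sub (ups \<sigma>) (wk t) = wk (sub \<sigma> t)"
  by (simp add: sub_ren ren_sub comp_def)

lemma ren_eq_sub: "ren \<rho> t = sub (Var \<circ> \<rho>) t"
  using sub_ren[of Var \<rho> t] by simp

lemma sub_Arr [simp]: "sub \<sigma> (A \<rightarrow>\<^sub>t B) = sub \<sigma> A \<rightarrow>\<^sub>t sub \<sigma> B"
  and sub_isProp [simp]: "sub \<sigma> (isProp A) = isProp (sub \<sigma> A)"
  by (simp_all add: Arr_def isProp_def)

lemma sub_ups_comp_ups: "sub (ups \<sigma>) \<circ> ups \<tau> = ups (sub \<sigma> \<circ> \<tau>)"
proof
  show "(sub (ups \<sigma>) \<circ> ups \<tau>) n = ups (sub \<sigma> \<circ> \<tau>) n" for n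
    by (cases n) simp_all
qed

lemma sub_sub: "sub \<sigma> (sub \<tau> t) = sub (sub \<sigma> \<circ> \<tau>) t"
  by (induction t arbitrary: \<sigma> \<tau>) (simp_all add: sub_ups_comp_ups)

lemma sub_comp_scons: "sub \<sigma> \<circ> (a \<bullet> \<tau>) = sub \<sigma> a \<bullet> (sub \<sigma> \<circ> \<tau>)"
proof
  show "(sub \<sigma> \<circ> (a \<bullet> \<tau>)) n = (sub \<sigma> a \<bullet> (sub \<sigma> \<circ> \<tau>)) n" for n
    by (cases n) simp_all
qed

lemma sub_scons_comp_ups: "sub (a \<bullet> \<tau>) \<circ> ups \<sigma> = a \<bullet> (sub \<tau> \<circ> \<sigma>)"
proof
  show "(sub (a \<bullet> \<tau>) \<circ> ups \<sigma>) n = (a \<bullet> (sub \<tau> \<circ> \<sigma>)) n" for n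
    by (cases n) simp_all
qed

lemma sub_Var_Suc: "sub (\<lambda>k. Var (Suc k)) t = wk t"
  by (simp add: ren_eq_sub comp_def)

lemma sub_Var_Suc_Suc: "sub (\<lambda>k. Var (Suc (Suc k))) t = wk (wk t)"
  by (simp add: ren_eq_sub sub_sub comp_def)

lemma sub_inst:
  "sub \<sigma> (inst1 B a) = inst1 (sub (ups \<sigma>) B) (sub \<sigma> a)"
  "sub \<sigma> (inst2 C a b) = inst2 (sub (ups (ups \<sigma>)) C) (sub \<sigma> a) (sub \<sigma> b)"
  unfolding sub_sub sub_comp_scons sub_scons_comp_ups by (simp_all add: comp_def)

lemma sub_branch_type:
  "sub (ups \<sigma>) (sub (InL (Var 0) \<bullet> (\<lambda>k. Var (k + 1))) C)
    = sub (InL (Var 0) \<bullet> (\<lambda>k. Var (k + 1))) (sub (ups \<sigma>) C)"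
  "sub (ups \<sigma>) (sub (InR (Var 0) \<bullet> (\<lambda>k. Var (k + 1))) C)
    = sub (InR (Var 0) \<bullet> (\<lambda>k. Var (k + 1))) (sub (ups \<sigma>) C)"
  "sub (ups (ups \<sigma>)) (sub (Succ (Var 1) \<bullet> (\<lambda>k. Var (k + 2))) C)
    = sub (Succ (Var 1) \<bullet> (\<lambda>k. Var (k + 2))) (sub (ups \<sigma>) C)"
  unfolding sub_sub sub_comp_scons sub_scons_comp_ups
  by (simp_all add: comp_def sub_Var_Suc sub_Var_Suc_Suc)

section \<open>Stability of the judgements under substitution\<close>

lemma context_well_formed:
  "(\<turnstile> \<Gamma> \<longrightarrow> True) \<and> (\<Gamma> \<turnstile> t \<Colon> T \<longrightarrow> \<turnstile> \<Gamma>) \<and> (\<Gamma> \<turnstile> t \<doteq> u \<Colon> T \<longrightarrow> \<turnstile> \<Gamma>)"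
  by (rule ctx_has_jeq.induct) simp_all

lemma has_ctx: "\<Gamma> \<turnstile> t \<Colon> T \<Longrightarrow> \<turnstile> \<Gamma>"
  and jeq_ctx: "\<Gamma> \<turnstile> t \<doteq> u \<Colon> T \<Longrightarrow> \<turnstile> \<Gamma>"
  using context_well_formed by blast+

definition has_subst :: "tm list \<Rightarrow> (nat \<Rightarrow> tm) \<Rightarrow> tm list \<Rightarrow> bool" where
  "has_subst \<Delta> \<sigma> \<Gamma> \<longleftrightarrow>
    \<turnstile> \<Delta> \<and> (\<forall>n < length \<Gamma>. \<Delta> \<turnstile> \<sigma> n \<Colon> sub \<sigma> (ren (\<lambda>k. k + Suc n) (\<Gamma> ! n)))"

definition liftable :: "(tm list \<Rightarrow> (nat \<Rightarrow> tm) \<Rightarrow> tm list \<Rightarrow> bool) \<Rightarrow> bool" where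
  "liftable M \<longleftrightarrow> (\<forall>\<Delta> \<sigma> \<Gamma>. M \<Delta> \<sigma> \<Gamma> \<longrightarrow> has_subst \<Delta> \<sigma> \<Gamma>)
    \<and> (\<forall>\<Delta> \<sigma> \<Gamma> A. M \<Delta> \<sigma> \<Gamma> \<longrightarrow> \<turnstile> sub \<sigma> A # \<Delta> \<longrightarrow> M (sub \<sigma> A # \<Delta>) (ups \<sigma>) (A # \<Gamma>))"

primrec ctx_stable :: "(tm list \<Rightarrow> (nat \<Rightarrow> tm) \<Rightarrow> tm list \<Rightarrow> bool) \<Rightarrow> tm list \<Rightarrow> bool" where
  "ctx_stable M [] \<longleftrightarrow> True"
| "ctx_stable M (A # \<Gamma>) \<longleftrightarrow> ctx_stable M \<Gamma> \<and> (\<forall>\<Delta> \<sigma>. M \<Delta> \<sigma> \<Gamma> \<longrightarrow> \<turnstile> sub \<sigma> A # \<Delta>)"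

text \<open>Recording \<open>ctx_stable\<close> in the invariant is what carries the induction through rules such as
  \<open>Sig_I\<close>, which have a premise over \<open>A # \<Gamma>\<close> but none that types \<open>A\<close>.\<close>

definition stable :: "(tm list \<Rightarrow> (nat \<Rightarrow> tm) \<Rightarrow> tm list \<Rightarrow> bool) \<Rightarrow> tm list
    \<Rightarrow> (tm list \<Rightarrow> (nat \<Rightarrow> tm) \<Rightarrow> bool) \<Rightarrow> bool" where
  "stable M \<Gamma> P \<longleftrightarrow> ctx_stable M \<Gamma> \<and> (\<forall>\<Delta> \<sigma>. M \<Delta> \<sigma> \<Gamma> \<longrightarrow> P \<Delta> \<sigma>)"

lemma stableI:
  assumes "liftable M" and "ctx_stable M \<Gamma>" and "\<And>\<Delta> \<sigma>. M \<Delta> \<sigma> \<Gamma> \<Longrightarrow> \<turnstile> \<Delta> \<Longrightarrow> P \<Delta> \<sigma>"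
  shows "stable M \<Gamma> P"
  using assms by (auto simp: stable_def liftable_def has_subst_def)

lemma stable_ctx_stable: "stable M \<Gamma> P \<Longrightarrow> ctx_stable M \<Gamma>"
  by (simp add: stable_def)

lemma stableD: "stable M \<Gamma> P \<Longrightarrow> M \<Delta> \<sigma> \<Gamma> \<Longrightarrow> P \<Delta> \<sigma>"
  by (simp add: stable_def)

lemma stable_ConsD:
  "liftable M \<Longrightarrow> stable M (A # \<Gamma>) P \<Longrightarrow> M \<Delta> \<sigma> \<Gamma> \<Longrightarrow> P (sub \<sigma> A # \<Delta>) (ups \<sigma>)"
  by (simp add: stable_def liftable_def)

lemma stable_Cons_ConsD:
  "liftable M \<Longrightarrow> stable M (A # B # \<Gamma>) P \<Longrightarrow> M \<Delta> \<sigma> \<Gamma>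
    \<Longrightarrow> P (sub (ups \<sigma>) A # sub \<sigma> B # \<Delta>) (ups (ups \<sigma>))"
  by (simp add: stable_def liftable_def)

lemma judgements_stable:
  assumes lift: "liftable M"
  shows "(\<turnstile> \<Gamma> \<longrightarrow> ctx_stable M \<Gamma>)
    \<and> (\<Gamma> \<turnstile> t \<Colon> T \<longrightarrow> stable M \<Gamma> (\<lambda>\<Delta> \<sigma>. \<Delta> \<turnstile> sub \<sigma> t \<Colon> sub \<sigma> T))
    \<and> (\<Gamma> \<turnstile> t \<doteq> u \<Colon> T \<longrightarrow> stable M \<Gamma> (\<lambda>\<Delta> \<sigma>. \<Delta> \<turnstile> sub \<sigma> t \<doteq> sub \<sigma> u \<Colon> sub \<sigma> T))"
proof -
  note sub_simps = sub.simps sub_inst sub_branch_type sub_ups_wk sub_Arr sub_isProp ups_simps(1)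
  note stableDs = stable_Cons_ConsD[OF lift] stable_ConsD[OF lift] stableD
  show ?thesis
    \<comment> \<open>Uniformly in all rules except \<open>ctx_Cons\<close> and \<open>Var\<close>: instantiate the induction hypotheses at
      the lifted substitution, push it to the leaves, and apply the same rule again.\<close>
  proof (rule ctx_has_jeq.induct; (rule stableI[OF lift])?; (assumption | erule stable_ctx_stable)?;
      ((drule (1) stableDs)+)?; (unfold sub_simps)?; (rule ctx_has_jeq.intros; assumption)?)
    show "ctx_stable M []"
      by simp
  next
    fix \<Gamma> A i
    assume "ctx_stable M \<Gamma>" and "stable M \<Gamma> (\<lambda>\<Delta> \<sigma>. \<Delta> \<turnstile> sub \<sigma> A \<Colon> Univ i)"
    with lift show "ctx_stable M (A # \<Gamma>)"
      unfolding ctx_stable.simps stable_def liftable_def has_subst_def by (blast intro: ctx_Cons)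
  next
    fix \<Gamma> \<Delta> \<sigma> and n :: nat
    assume "n < length \<Gamma>" and "M \<Delta> \<sigma> \<Gamma>"
    with lift show "\<Delta> \<turnstile> \<sigma> n \<Colon> sub \<sigma> (ren (\<lambda>k. k + Suc n) (\<Gamma> ! n))"
      by (simp add: liftable_def has_subst_def)
  qed
qed

text \<open>Substitutions by variables come first, since lifting an arbitrary substitution uses weakening.\<close>

definition has_renaming :: "tm list \<Rightarrow> (nat \<Rightarrow> tm) \<Rightarrow> tm list \<Rightarrow> bool" where
  "has_renaming \<Delta> \<sigma> \<Gamma> \<longleftrightarrow> \<turnstile> \<Delta> \<and> (\<exists>\<rho>. \<sigma> = Var \<circ> \<rho> \<and> (\<forall>n < length \<Gamma>. \<rho> n < length \<Delta> \<and>
    ren (\<lambda>k. k + Suc (\<rho> n)) (\<Delta> ! \<rho> n) = ren \<rho> (ren (\<lambda>k. k + Suc n) (\<Gamma> ! n))))"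

lemma has_renaming_has_subst:
  assumes "has_renaming \<Delta> \<sigma> \<Gamma>"
  shows "has_subst \<Delta> \<sigma> \<Gamma>"
proof -
  obtain \<rho> where "\<turnstile> \<Delta>" and \<sigma>: "\<sigma> = Var \<circ> \<rho>" and \<rho>: "\<forall>n < length \<Gamma>. \<rho> n < length \<Delta> \<and>
      ren (\<lambda>k. k + Suc (\<rho> n)) (\<Delta> ! \<rho> n) = ren \<rho> (ren (\<lambda>k. k + Suc n) (\<Gamma> ! n))"
    using assms by (auto simp: has_renaming_def)
  have "\<Delta> \<turnstile> \<sigma> n \<Colon> sub \<sigma> (ren (\<lambda>k. k + Suc n) (\<Gamma> ! n))" if "n < length \<Gamma>" for n
    using ctx_has_jeq.Var[OF \<open>\<turnstile> \<Delta>\<close>, of "\<rho> n"] \<rho> that by (simp add: \<sigma> flip: ren_eq_sub)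
  with \<open>\<turnstile> \<Delta>\<close> show ?thesis
    by (simp add: has_subst_def)
qed

lemma has_renaming_ups:
  assumes "has_renaming \<Delta> \<sigma> \<Gamma>" and "\<turnstile> sub \<sigma> A # \<Delta>"
  shows "has_renaming (sub \<sigma> A # \<Delta>) (ups \<sigma>) (A # \<Gamma>)"
proof -
  obtain \<rho> where \<sigma>: "\<sigma> = Var \<circ> \<rho>" and \<rho>: "\<forall>n < length \<Gamma>. \<rho> n < length \<Delta> \<and>
      ren (\<lambda>k. k + Suc (\<rho> n)) (\<Delta> ! \<rho> n) = ren \<rho> (ren (\<lambda>k. k + Suc n) (\<Gamma> ! n))"
    using assms(1) by (auto simp: has_renaming_def)
  have "upr \<rho> n < Suc (length \<Delta>) \<and> ren (\<lambda>k. k + Suc (upr \<rho> n)) ((ren \<rho> A # \<Delta>) ! upr \<rho> n)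
      = ren (upr \<rho>) (ren (\<lambda>k. k + Suc n) ((A # \<Gamma>) ! n))" if "n < Suc (length \<Gamma>)" for n
  proof (cases n)
    case 0
    then show ?thesis by (simp add: ren_ren comp_def)
  next
    case (Suc m)
    have "ren (\<lambda>k. Suc (k + Suc (\<rho> m))) (\<Delta> ! \<rho> m) = wk (ren (\<lambda>k. k + Suc (\<rho> m)) (\<Delta> ! \<rho> m))"
      by (simp add: ren_ren comp_def)
    with Suc that \<rho> show ?thesis
      by (simp add: ren_ren comp_def)
  qed
  with assms(2) show ?thesis
    by (auto simp: has_renaming_def \<sigma> ups_Var_comp simp flip: ren_eq_sub)
qed

lemma liftable_has_renaming: "liftable has_renaming"
  by (simp add: liftable_def has_renaming_has_subst has_renaming_ups)

lemma has_renaming_wk: "\<turnstile> A # \<Gamma> \<Longrightarrow> has_renaming (A # \<Gamma>) (Var \<circ> Suc) \<Gamma>"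
  by (auto simp: has_renaming_def ren_ren comp_def intro!: exI[of _ Suc])

lemma weaken_has:
  assumes "\<Gamma> \<turnstile> t \<Colon> T" and "\<turnstile> A # \<Gamma>"
  shows "A # \<Gamma> \<turnstile> wk t \<Colon> wk T"
  using judgements_stable[OF liftable_has_renaming] assms unfolding ren_eq_sub
  by (blast dest: stableD has_renaming_wk)

lemma weaken_jeq:
  assumes "\<Gamma> \<turnstile> t \<doteq> u \<Colon> T" and "\<turnstile> A # \<Gamma>"
  shows "A # \<Gamma> \<turnstile> wk t \<doteq> wk u \<Colon> wk T"
  using judgements_stable[OF liftable_has_renaming] assms unfolding ren_eq_sub
  by (blast dest: stableD has_renaming_wk)

lemma has_subst_ups:
  assumes "has_subst \<Delta> \<sigma> \<Gamma>" and "\<turnstile> sub \<sigma> A # \<Delta>"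
  shows "has_subst (sub \<sigma> A # \<Delta>) (ups \<sigma>) (A # \<Gamma>)"
proof -
  have "sub \<sigma> A # \<Delta> \<turnstile> ups \<sigma> n \<Colon> sub (ups \<sigma>) (ren (\<lambda>k. k + Suc n) ((A # \<Gamma>) ! n))"
    if "n < Suc (length \<Gamma>)" for n
  proof (cases n)
    case 0
    then show ?thesis
      using ctx_has_jeq.Var[OF assms(2), of 0] by simp
  next
    case (Suc m)
    then have "\<Delta> \<turnstile> \<sigma> m \<Colon> sub \<sigma> (ren (\<lambda>k. k + Suc m) (\<Gamma> ! m))"
      using that assms(1) by (simp add: has_subst_def)
    from weaken_has[OF this assms(2)] Suc show ?thesis
      by (simp add: ren_ren comp_def flip: sub_ups_wk)
  qed
  with assms(2) show ?thesis
    by (simp add: has_subst_def)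
qed

lemma liftable_has_subst: "liftable has_subst"
  by (simp add: liftable_def has_subst_ups)

lemma sub_has:
  assumes "\<Gamma> \<turnstile> t \<Colon> T" and "has_subst \<Delta> \<sigma> \<Gamma>"
  shows "\<Delta> \<turnstile> sub \<sigma> t \<Colon> sub \<sigma> T"
  using judgements_stable[OF liftable_has_subst] assms by (blast dest: stableD)

lemma has_subst_inst1:
  assumes "\<Gamma> \<turnstile> a \<Colon> A"
  shows "has_subst \<Gamma> (a \<bullet> Var) (A # \<Gamma>)"
proof -
  have "\<Gamma> \<turnstile> (a \<bullet> Var) n \<Colon> sub (a \<bullet> Var) (ren (\<lambda>k. k + Suc n) ((A # \<Gamma>) ! n))"
    if "n < Suc (length \<Gamma>)" for n
  proof (cases n)
    case 0
    with assms show ?thesis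
      by (simp add: sub_ren comp_def)
  next
    case (Suc m)
    then have "sub (a \<bullet> Var) (ren (\<lambda>k. k + Suc n) ((A # \<Gamma>) ! n)) = ren (\<lambda>k. k + Suc m) (\<Gamma> ! m)"
      by (simp add: sub_ren comp_def ren_eq_sub[of "\<lambda>k. Suc (k + m)"])
    then show ?thesis
      using Suc that ctx_has_jeq.Var[OF has_ctx[OF assms], of m] by simp
  qed
  with assms show ?thesis
    by (simp add: has_subst_def has_ctx)
qed

lemma inst1_has: "A # \<Gamma> \<turnstile> t \<Colon> T \<Longrightarrow> \<Gamma> \<turnstile> a \<Colon> A \<Longrightarrow> \<Gamma> \<turnstile> inst1 t a \<Colon> inst1 T a"
  by (blast intro: sub_has has_subst_inst1)

lemma has_subst_wk:
  assumes "\<turnstile> A # \<Gamma>"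
  shows "has_subst (A # \<Gamma>) (\<lambda>k. Var (Suc k)) \<Gamma>"
  using has_renaming_has_subst[OF has_renaming_wk[OF assms]] by (simp add: comp_def)

lemma has_subst_wk_wk:
  assumes "\<turnstile> B # A # \<Gamma>"
  shows "has_subst (B # A # \<Gamma>) (\<lambda>k. Var (Suc (Suc k))) \<Gamma>"
proof -
  have "B # A # \<Gamma> \<turnstile> Var (Suc (Suc n)) \<Colon> wk (wk (ren (\<lambda>k. k + Suc n) (\<Gamma> ! n)))" if "n < length \<Gamma>" for n
    using ctx_has_jeq.Var[OF assms, of "Suc (Suc n)"] that by (simp add: ren_ren comp_def)
  with assms show ?thesis
    unfolding has_subst_def sub_Var_Suc_Suc by blast
qed

section \<open>Types and inhabited types\<close>

definition is_type :: "tm list \<Rightarrow> tm \<Rightarrow> bool" where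
  "is_type \<Gamma> A \<longleftrightarrow> (\<exists>i. \<Gamma> \<turnstile> A \<Colon> Univ i)"

definition inhabited :: "tm list \<Rightarrow> tm \<Rightarrow> bool" ("_ \<tturnstile> _" [50, 50] 50) where
  "\<Gamma> \<tturnstile> T \<longleftrightarrow> (\<exists>t. \<Gamma> \<turnstile> t \<Colon> T)"

lemma has_Univ_is_type: "\<Gamma> \<turnstile> A \<Colon> Univ i \<Longrightarrow> is_type \<Gamma> A"
  by (auto simp: is_type_def)

lemma has_inhabited: "\<Gamma> \<turnstile> t \<Colon> T \<Longrightarrow> \<Gamma> \<tturnstile> T"
  by (auto simp: inhabited_def)

lemma is_type_ctx: "is_type \<Gamma> A \<Longrightarrow> \<turnstile> \<Gamma>"
  by (auto simp: is_type_def intro: has_ctx)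

lemma ctx_Cons_iff [simp]: "\<turnstile> A # \<Gamma> \<longleftrightarrow> is_type \<Gamma> A"
proof
  show "\<turnstile> A # \<Gamma> \<Longrightarrow> is_type \<Gamma> A"
    by (erule ctx.cases) (auto simp: is_type_def)
  show "is_type \<Gamma> A \<Longrightarrow> \<turnstile> A # \<Gamma>"
    by (auto simp: is_type_def intro: ctx_Cons has_ctx)
qed

lemma has_head_is_type: "A # \<Gamma> \<turnstile> t \<Colon> T \<Longrightarrow> is_type \<Gamma> A"
  using has_ctx by fastforce

lemma is_type_head_is_type: "is_type (A # \<Gamma>) B \<Longrightarrow> is_type \<Gamma> A"
  using is_type_ctx by fastforce

lemma sub_is_type: "is_type \<Gamma> A \<Longrightarrow> has_subst \<Delta> \<sigma> \<Gamma> \<Longrightarrow> is_type \<Delta> (sub \<sigma> A)"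
  using sub_has[of \<Gamma> A "Univ i" \<Delta> \<sigma> for i] by (auto simp: is_type_def)

lemma inst1_is_type: "is_type (A # \<Gamma>) B \<Longrightarrow> \<Gamma> \<turnstile> a \<Colon> A \<Longrightarrow> is_type \<Gamma> (inst1 B a)"
  by (blast intro: sub_is_type has_subst_inst1)

lemma weaken_is_type [simp]: "is_type \<Gamma> T \<Longrightarrow> is_type \<Gamma> A \<Longrightarrow> is_type (A # \<Gamma>) (wk T)"
  using weaken_has[of \<Gamma> T "Univ i" A for i] by (auto simp: is_type_def)

lemma weaken_inhabited: "\<Gamma> \<tturnstile> T \<Longrightarrow> is_type \<Gamma> A \<Longrightarrow> A # \<Gamma> \<tturnstile> wk T"
  using weaken_has[of \<Gamma> _ T A] by (auto simp: inhabited_def)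

lemma weaken_has_Univ [simp]: "\<Gamma> \<turnstile> P \<Colon> Univ i \<Longrightarrow> is_type \<Gamma> A \<Longrightarrow> A # \<Gamma> \<turnstile> wk P \<Colon> Univ i"
  using weaken_has[of \<Gamma> P "Univ i"] by simp

lemma weaken_has_Two [simp]: "\<Gamma> \<turnstile> b \<Colon> TwoT \<Longrightarrow> is_type \<Gamma> A \<Longrightarrow> A # \<Gamma> \<turnstile> wk b \<Colon> TwoT"
  using weaken_has[of \<Gamma> b TwoT] by simp

lemma weaken_has_Nat [simp]: "\<Gamma> \<turnstile> n \<Colon> NatT \<Longrightarrow> is_type \<Gamma> A \<Longrightarrow> A # \<Gamma> \<turnstile> wk n \<Colon> NatT"
  using weaken_has[of \<Gamma> n NatT] by simp

lemma has_cumulative: "\<Gamma> \<turnstile> A \<Colon> Univ i \<Longrightarrow> i \<le> j \<Longrightarrow> \<Gamma> \<turnstile> A \<Colon> Univ j"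
  by (induction j) (auto simp: le_Suc_eq intro: Cumul)

lemma is_type_common_level:
  assumes "is_type \<Gamma> A" and "is_type \<Delta> B"
  obtains i where "\<Gamma> \<turnstile> A \<Colon> Univ i" and "\<Delta> \<turnstile> B \<Colon> Univ i"
proof -
  obtain j k where "\<Gamma> \<turnstile> A \<Colon> Univ j" and "\<Delta> \<turnstile> B \<Colon> Univ k"
    using assms by (auto simp: is_type_def)
  then have "\<Gamma> \<turnstile> A \<Colon> Univ (max j k)" and "\<Delta> \<turnstile> B \<Colon> Univ (max j k)"
    by (auto elim: has_cumulative)
  then show thesis
    by (rule that)
qed

lemma has_Var: "\<turnstile> \<Gamma> \<Longrightarrow> n < length \<Gamma> \<Longrightarrow> ren (\<lambda>k. k + Suc n) (\<Gamma> ! n) = T \<Longrightarrow> \<Gamma> \<turnstile> Var n \<Colon> T"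
  using ctx_has_jeq.Var by blast

lemma has_Var_0 [simp]: "is_type \<Gamma> A \<Longrightarrow> wk A = T \<Longrightarrow> A # \<Gamma> \<turnstile> Var 0 \<Colon> T"
  by (rule has_Var) simp_all

lemma has_Var_1 [simp]: "is_type (A # \<Gamma>) B \<Longrightarrow> wk (wk A) = T \<Longrightarrow> B # A # \<Gamma> \<turnstile> Var (Suc 0) \<Colon> T"
  by (rule has_Var) (simp_all add: ren_ren comp_def)

lemma is_type_Univ [simp]: "\<turnstile> \<Gamma> \<Longrightarrow> is_type \<Gamma> (Univ i)"
  by (rule has_Univ_is_type) (rule Univ_F)

lemma is_type_Var_Univ [simp]: "\<turnstile> \<Gamma> \<Longrightarrow> is_type (Univ i # \<Gamma>) (Var 0)"
  by (rule has_Univ_is_type[of _ _ i]) simp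

lemma is_type_Two [simp]: "\<turnstile> \<Gamma> \<Longrightarrow> is_type \<Gamma> TwoT"
  by (rule has_Univ_is_type) (rule Two_F)

lemma is_type_Nat [simp]: "\<turnstile> \<Gamma> \<Longrightarrow> is_type \<Gamma> NatT"
  by (rule has_Univ_is_type) (rule Nat_F)

lemma is_type_Pi [simp]: "is_type \<Gamma> A \<Longrightarrow> is_type (A # \<Gamma>) B \<Longrightarrow> is_type \<Gamma> (PiT A B)"
  by (erule (1) is_type_common_level) (auto intro: has_Univ_is_type Pi_F)

lemma is_type_Sig [simp]: "is_type \<Gamma> A \<Longrightarrow> is_type (A # \<Gamma>) B \<Longrightarrow> is_type \<Gamma> (SigT A B)"
  by (erule (1) is_type_common_level) (auto intro: has_Univ_is_type Sig_F)

lemma is_type_Arr [simp]: "is_type \<Gamma> A \<Longrightarrow> is_type \<Gamma> B \<Longrightarrow> is_type \<Gamma> (A \<rightarrow>\<^sub>t B)"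
  by (simp add: Arr_def)

lemma is_type_Id [simp]: "is_type \<Gamma> A \<Longrightarrow> \<Gamma> \<turnstile> a \<Colon> A \<Longrightarrow> \<Gamma> \<turnstile> b \<Colon> A \<Longrightarrow> is_type \<Gamma> (IdT A a b)"
  by (auto simp: is_type_def intro: Id_F)

lemma is_type_Id_Nat [simp]: "\<Gamma> \<turnstile> n \<Colon> NatT \<Longrightarrow> \<Gamma> \<turnstile> m \<Colon> NatT \<Longrightarrow> is_type \<Gamma> (IdT NatT n m)"
  using has_ctx[of \<Gamma> n NatT] by simp

lemma is_type_Trunc [simp]: "is_type \<Gamma> A \<Longrightarrow> is_type \<Gamma> (Trunc A)"
  by (auto simp: is_type_def intro: Trunc_F)

lemma is_type_isProp [simp]: "is_type \<Gamma> A \<Longrightarrow> is_type \<Gamma> (isProp A)"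
  by (simp add: isProp_def)

lemma has_Two0 [simp]: "\<turnstile> \<Gamma> \<Longrightarrow> \<Gamma> \<turnstile> Two0 \<Colon> TwoT"
  by (rule Two0_I)

lemma has_Two1 [simp]: "\<turnstile> \<Gamma> \<Longrightarrow> \<Gamma> \<turnstile> Two1 \<Colon> TwoT"
  by (rule Two1_I)

lemma has_Zero [simp]: "\<turnstile> \<Gamma> \<Longrightarrow> \<Gamma> \<turnstile> Zero \<Colon> NatT"
  by (rule Zero_I)

lemma has_Succ [simp]: "\<Gamma> \<turnstile> n \<Colon> NatT \<Longrightarrow> \<Gamma> \<turnstile> Succ n \<Colon> NatT"
  by (rule Succ_I)

lemma has_Refl [simp]: "\<Gamma> \<turnstile> a \<Colon> A \<Longrightarrow> \<Gamma> \<turnstile> Refl a \<Colon> IdT A a a"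
  by (rule Id_I)

lemma has_Lam_Arr: "A # \<Gamma> \<turnstile> b \<Colon> wk B \<Longrightarrow> \<Gamma> \<turnstile> Lam A b \<Colon> A \<rightarrow>\<^sub>t B"
  using has_head_is_type[of A \<Gamma> b] by (auto simp: Arr_def is_type_def intro: Pi_I)

lemma has_App_Arr: "\<Gamma> \<turnstile> f \<Colon> A \<rightarrow>\<^sub>t B \<Longrightarrow> \<Gamma> \<turnstile> a \<Colon> A \<Longrightarrow> \<Gamma> \<turnstile> App f a \<Colon> B"
  using Pi_E[of \<Gamma> f A "wk B" a] by (simp add: Arr_def)

lemma App_Arr_cong: "\<Gamma> \<turnstile> f \<doteq> g \<Colon> A \<rightarrow>\<^sub>t B \<Longrightarrow> \<Gamma> \<turnstile> a \<Colon> A \<Longrightarrow> \<Gamma> \<turnstile> App f a \<doteq> App g a \<Colon> B"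
  using Pi_E_C[of \<Gamma> f g A "wk B" a a] by (simp add: Arr_def Eq_refl)

lemma App_Lam_Arr:
  assumes "A # \<Gamma> \<turnstile> b \<Colon> wk B" and "\<Gamma> \<turnstile> a \<Colon> A"
  shows "\<Gamma> \<turnstile> App (Lam A b) a \<doteq> inst1 b a \<Colon> B"
  using has_head_is_type[OF assms(1)] Pi_beta[of \<Gamma> A _ b "wk B" a] assms by (auto simp: is_type_def)

lemma has_MkPair: "is_type (A # \<Gamma>) B \<Longrightarrow> \<Gamma> \<turnstile> a \<Colon> A \<Longrightarrow> \<Gamma> \<turnstile> b \<Colon> inst1 B a \<Longrightarrow> \<Gamma> \<turnstile> MkPair a b \<Colon> SigT A B"
  by (auto simp: is_type_def intro: Sig_I)

section \<open>Natural deduction for inhabited types\<close>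

lemma inhabited_ctx: "\<Gamma> \<tturnstile> T \<Longrightarrow> \<turnstile> \<Gamma>"
  by (auto simp: inhabited_def intro: has_ctx)

lemma inhabited_conv: "\<Gamma> \<tturnstile> A \<Longrightarrow> \<Gamma> \<turnstile> A \<doteq> B \<Colon> Univ i \<Longrightarrow> \<Gamma> \<tturnstile> B"
  by (auto simp: inhabited_def intro: Conv)

lemma inhabited_head: "is_type \<Gamma> A \<Longrightarrow> A # \<Gamma> \<tturnstile> wk A"
  by (rule has_inhabited[OF has_Var_0]) simp_all

lemma inhabited_second: "is_type (A # \<Gamma>) B \<Longrightarrow> B # A # \<Gamma> \<tturnstile> wk (wk A)"
  by (rule has_inhabited[OF has_Var_1]) simp_all

lemma inhabited_PiI: "A # \<Gamma> \<tturnstile> B \<Longrightarrow> \<Gamma> \<tturnstile> PiT A B"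
  using inhabited_ctx[of "A # \<Gamma>" B] by (auto simp: inhabited_def is_type_def intro: Pi_I)

lemma inhabited_PiE: "\<Gamma> \<tturnstile> PiT A B \<Longrightarrow> \<Gamma> \<turnstile> a \<Colon> A \<Longrightarrow> \<Gamma> \<tturnstile> inst1 B a"
  by (auto simp: inhabited_def intro: Pi_E)

lemma inhabited_inst1: "A # \<Gamma> \<tturnstile> B \<Longrightarrow> \<Gamma> \<turnstile> a \<Colon> A \<Longrightarrow> \<Gamma> \<tturnstile> inst1 B a"
  by (rule inhabited_PiE[OF inhabited_PiI])

lemma inhabited_PiD:
  assumes "\<Gamma> \<tturnstile> PiT A B" and A_type: "is_type \<Gamma> A"
  shows "A # \<Gamma> \<tturnstile> B"
proof -
  have "A # \<Gamma> \<tturnstile> PiT (wk A) (ren (upr Suc) B)"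
    using weaken_inhabited[OF assms] by simp
  from inhabited_PiE[OF this has_Var_0[OF A_type refl]] have "A # \<Gamma> \<tturnstile> sub ((Var 0 \<bullet> Var) \<circ> upr Suc) B"
    by (simp add: sub_ren)
  moreover have "(Var 0 \<bullet> Var) \<circ> upr Suc = Var"
    by (rule ext) (simp add: scons_def upr_def split: nat.split)
  ultimately show ?thesis
    by simp
qed

lemma inhabited_ArrI: "A # \<Gamma> \<tturnstile> wk B \<Longrightarrow> \<Gamma> \<tturnstile> A \<rightarrow>\<^sub>t B"
  unfolding Arr_def by (rule inhabited_PiI)

lemma inhabited_Arr_ArrI: "wk B # A # \<Gamma> \<tturnstile> wk (wk C) \<Longrightarrow> \<Gamma> \<tturnstile> A \<rightarrow>\<^sub>t B \<rightarrow>\<^sub>t C"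
  by (simp add: inhabited_ArrI)

lemma inhabited_Arr_const: "\<Gamma> \<tturnstile> B \<Longrightarrow> is_type \<Gamma> A \<Longrightarrow> \<Gamma> \<tturnstile> A \<rightarrow>\<^sub>t B"
  by (rule inhabited_ArrI) (rule weaken_inhabited)

lemma inhabited_ArrE: "\<Gamma> \<tturnstile> A \<rightarrow>\<^sub>t B \<Longrightarrow> \<Gamma> \<tturnstile> A \<Longrightarrow> \<Gamma> \<tturnstile> B"
  by (auto simp: inhabited_def intro: has_App_Arr)

lemma inhabited_Arr_trans:
  assumes "\<Gamma> \<tturnstile> A \<rightarrow>\<^sub>t B" and "\<Gamma> \<tturnstile> B \<rightarrow>\<^sub>t C" and A_type: "is_type \<Gamma> A"
  shows "\<Gamma> \<tturnstile> A \<rightarrow>\<^sub>t C"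
proof (rule inhabited_ArrI)
  have "A # \<Gamma> \<tturnstile> wk A \<rightarrow>\<^sub>t wk B" and "A # \<Gamma> \<tturnstile> wk B \<rightarrow>\<^sub>t wk C"
    using weaken_inhabited[OF assms(1) A_type] weaken_inhabited[OF assms(2) A_type] by simp_all
  then show "A # \<Gamma> \<tturnstile> wk C"
    using inhabited_head[OF A_type] inhabited_ArrE by blast
qed

lemma inhabited_SigI:
  "is_type (A # \<Gamma>) B \<Longrightarrow> \<Gamma> \<turnstile> a \<Colon> A \<Longrightarrow> \<Gamma> \<tturnstile> inst1 B a \<Longrightarrow> \<Gamma> \<tturnstile> SigT A B"
  by (auto simp: inhabited_def intro: has_MkPair)

lemma inhabited_SigE:
  assumes "\<Gamma> \<tturnstile> SigT A B"
  obtains a where "\<Gamma> \<turnstile> a \<Colon> A" and "\<Gamma> \<tturnstile> inst1 B a"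
  using assms by (auto simp: inhabited_def intro: Fst_E Snd_E)

lemma inhabited_IffI:
  assumes "\<Gamma> \<tturnstile> A \<rightarrow>\<^sub>t B" and "\<Gamma> \<tturnstile> B \<rightarrow>\<^sub>t A" and "is_type \<Gamma> A" and "is_type \<Gamma> B"
  shows "\<Gamma> \<tturnstile> A \<leftrightarrow>\<^sub>t B"
proof -
  obtain f where "\<Gamma> \<turnstile> f \<Colon> A \<rightarrow>\<^sub>t B"
    using assms(1) by (auto simp: inhabited_def)
  with assms show ?thesis
    unfolding Iff_def Times_def by (intro inhabited_SigI[where a = f]) simp_all
qed

lemma inhabited_isPropI: "wk A # A # \<Gamma> \<tturnstile> IdT (wk (wk A)) (Var 1) (Var 0) \<Longrightarrow> \<Gamma> \<tturnstile> isProp A"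
  unfolding isProp_def by (intro inhabited_PiI)

lemma inhabited_isPropE:
  assumes "\<Gamma> \<tturnstile> isProp A" and "\<Gamma> \<turnstile> a \<Colon> A" and "\<Gamma> \<turnstile> b \<Colon> A"
  shows "\<Gamma> \<tturnstile> IdT A a b"
proof -
  have "\<Gamma> \<tturnstile> PiT A (IdT (wk A) (wk a) (Var 0))"
    using inhabited_PiE[OF assms(1)[unfolded isProp_def] assms(2)] by simp
  from inhabited_PiE[OF this assms(3)] show ?thesis
    by simp
qed

lemma inhabited_TruncI: "\<Gamma> \<tturnstile> A \<Longrightarrow> \<Gamma> \<tturnstile> Trunc A"
  by (auto simp: inhabited_def intro: Trunc_I)

lemma inhabited_isProp_Trunc:
  assumes "is_type \<Gamma> A"
  shows "\<Gamma> \<tturnstile> isProp (Trunc A)"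
proof (rule inhabited_isPropI)
  have "Trunc (wk A) # Trunc A # \<Gamma> \<turnstile> TrEq (Var 1) (Var 0) \<Colon> IdT (Trunc (wk (wk A))) (Var 1) (Var 0)"
    using assms by (intro Trunc_prop) simp_all
  then show "wk (Trunc A) # Trunc A # \<Gamma> \<tturnstile> IdT (wk (wk (Trunc A))) (Var 1) (Var 0)"
    by (simp add: has_inhabited)
qed

lemma inhabited_Trunc_bind:
  assumes "\<Gamma> \<tturnstile> Trunc A" and "A # \<Gamma> \<tturnstile> Trunc (wk B)" and B_type: "is_type \<Gamma> B"
  shows "\<Gamma> \<tturnstile> Trunc B"
proof -
  have "\<Gamma> \<tturnstile> A \<rightarrow>\<^sub>t Trunc B"
    using assms(2) by (simp add: inhabited_ArrI)
  moreover obtain i where "\<Gamma> \<turnstile> Trunc B \<Colon> Univ i"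
    using is_type_Trunc[OF B_type] by (auto simp: is_type_def)
  ultimately show ?thesis
    using assms(1) inhabited_isProp_Trunc[OF B_type] by (auto simp: inhabited_def intro: Trunc_E)
qed

lemma inhabited_Trunc_map:
  assumes "\<Gamma> \<tturnstile> Trunc A" and "A # \<Gamma> \<tturnstile> wk B" and "is_type \<Gamma> B"
  shows "\<Gamma> \<tturnstile> Trunc B"
  using assms by (auto intro: inhabited_Trunc_bind inhabited_TruncI)

lemma inhabited_Trunc_ArrE:
  assumes "\<Gamma> \<tturnstile> Trunc (A \<rightarrow>\<^sub>t B)" and "\<Gamma> \<tturnstile> A" and "is_type \<Gamma> A" and "is_type \<Gamma> B"
  shows "\<Gamma> \<tturnstile> Trunc B"
proof (rule inhabited_Trunc_map[OF assms(1)])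
  have Arr_type: "is_type \<Gamma> (A \<rightarrow>\<^sub>t B)"
    using assms(3,4) by simp
  then show "(A \<rightarrow>\<^sub>t B) # \<Gamma> \<tturnstile> wk B"
    using inhabited_ArrE[of _ "wk A" "wk B"] inhabited_head[OF Arr_type]
      weaken_inhabited[OF assms(2) Arr_type] by simp
qed (fact assms(4))

lemma inhabited_Two_induct:
  assumes "is_type (TwoT # \<Gamma>) C" and "\<Gamma> \<tturnstile> inst1 C Two0" and "\<Gamma> \<tturnstile> inst1 C Two1" and "\<Gamma> \<turnstile> b \<Colon> TwoT"
  shows "\<Gamma> \<tturnstile> inst1 C b"
  using assms by (auto simp: is_type_def inhabited_def intro: Two_E)

lemma inhabited_Nat_induct:
  assumes "is_type (NatT # \<Gamma>) C" and "\<Gamma> \<tturnstile> inst1 C Zero"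
    and "C # NatT # \<Gamma> \<tturnstile> sub (Succ (Var 1) \<bullet> (\<lambda>k. Var (k + 2))) C" and "\<Gamma> \<turnstile> n \<Colon> NatT"
  shows "\<Gamma> \<tturnstile> inst1 C n"
  using assms unfolding is_type_def inhabited_def by (blast intro: Nat_E)

lemma inhabited_Nat_cases:
  assumes C_type: "is_type (NatT # \<Gamma>) C" and "\<Gamma> \<tturnstile> inst1 C Zero"
    and "NatT # \<Gamma> \<tturnstile> sub (Succ (Var 0) \<bullet> (\<lambda>k. Var (k + 1))) C" and "\<Gamma> \<turnstile> n \<Colon> NatT"
  shows "\<Gamma> \<tturnstile> inst1 C n"
proof -
  have "C # NatT # \<Gamma> \<tturnstile> wk (sub (Succ (Var 0) \<bullet> (\<lambda>k. Var (k + 1))) C)"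
    using assms(3) C_type by (rule weaken_inhabited)
  also have "wk (sub (Succ (Var 0) \<bullet> (\<lambda>k. Var (k + 1))) C) = sub (Succ (Var 1) \<bullet> (\<lambda>k. Var (k + 2))) C"
    unfolding ren_eq_sub sub_sub sub_comp_scons by (simp add: comp_def)
  finally show ?thesis
    using inhabited_Nat_induct[OF C_type assms(2) _ assms(4)] by blast
qed

section \<open>Identity types\<close>

lemma inhabited_refl: "\<Gamma> \<turnstile> a \<Colon> A \<Longrightarrow> \<Gamma> \<tturnstile> IdT A a a"
  by (rule has_inhabited) (rule Id_I)

lemma inhabited_Id_of_jeq:
  assumes "\<Gamma> \<turnstile> a \<doteq> b \<Colon> A" and "\<Gamma> \<turnstile> a \<Colon> A" and "is_type \<Gamma> A"
  shows "\<Gamma> \<tturnstile> IdT A a b"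
proof -
  obtain i where "\<Gamma> \<turnstile> A \<Colon> Univ i"
    using assms(3) by (auto simp: is_type_def)
  then have "\<Gamma> \<turnstile> IdT A a a \<doteq> IdT A a b \<Colon> Univ i"
    using assms by (intro Id_F_C Eq_refl)
  with inhabited_refl[OF assms(2)] show ?thesis
    by (rule inhabited_conv)
qed

lemma inhabited_J:
  assumes "\<Gamma> \<turnstile> p \<Colon> IdT A a b" and "\<Gamma> \<turnstile> a \<Colon> A" and "\<Gamma> \<turnstile> b \<Colon> A"
    and "is_type (IdT (wk A) (wk a) (Var 0) # A # \<Gamma>) C" and "\<Gamma> \<tturnstile> inst2 C a (Refl a)"
  shows "\<Gamma> \<tturnstile> inst2 C b p"
  using assms by (auto simp: is_type_def inhabited_def intro: Id_E)

lemma inhabited_transport: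
  assumes "\<Gamma> \<tturnstile> IdT A a b" and "\<Gamma> \<turnstile> a \<Colon> A" and "\<Gamma> \<turnstile> b \<Colon> A"
    and "is_type (A # \<Gamma>) C" and "\<Gamma> \<tturnstile> inst1 C a"
  shows "\<Gamma> \<tturnstile> inst1 C b"
proof -
  obtain p where "\<Gamma> \<turnstile> p \<Colon> IdT A a b"
    using assms(1) by (auto simp: inhabited_def)
  then show ?thesis
    using inhabited_J[of \<Gamma> p A a b "wk C"] assms(2-) is_type_head_is_type[OF assms(4)]
    by (simp add: weaken_has)
qed

lemma inhabited_sym:
  assumes "\<Gamma> \<tturnstile> IdT A a b" and "\<Gamma> \<turnstile> a \<Colon> A" and "\<Gamma> \<turnstile> b \<Colon> A" and "is_type \<Gamma> A"
  shows "\<Gamma> \<tturnstile> IdT A b a"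
  using inhabited_transport[OF assms(1-3), of "IdT (wk A) (Var 0) (wk a)"] inhabited_refl[OF assms(2)]
    assms(2,4) by (simp add: weaken_has)

lemma inhabited_trans:
  assumes "\<Gamma> \<tturnstile> IdT A a b" and "\<Gamma> \<tturnstile> IdT A b c"
    and "\<Gamma> \<turnstile> a \<Colon> A" and "\<Gamma> \<turnstile> b \<Colon> A" and "\<Gamma> \<turnstile> c \<Colon> A" and "is_type \<Gamma> A"
  shows "\<Gamma> \<tturnstile> IdT A a c"
  using inhabited_transport[OF assms(2,4,5), of "IdT (wk A) (wk a) (Var 0)"] assms(1,3,6)
  by (simp add: weaken_has)

lemma inhabited_cong:
  assumes "\<Gamma> \<tturnstile> IdT A a b" and a_has: "\<Gamma> \<turnstile> a \<Colon> A" and "\<Gamma> \<turnstile> b \<Colon> A"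
    and f_has: "A # \<Gamma> \<turnstile> f \<Colon> wk B" and B_type: "is_type \<Gamma> B"
  shows "\<Gamma> \<tturnstile> IdT B (inst1 f a) (inst1 f b)"
proof -
  let ?C = "IdT (wk B) (wk (inst1 f a)) f"
  have fa_has: "\<Gamma> \<turnstile> inst1 f a \<Colon> B"
    using inst1_has[OF f_has a_has] by simp
  then have "is_type (A # \<Gamma>) ?C"
    using f_has B_type has_head_is_type[OF f_has] by (simp add: weaken_has)
  moreover have "\<Gamma> \<tturnstile> inst1 ?C a"
    using inhabited_refl[OF fa_has] by simp
  ultimately show ?thesis
    using inhabited_transport[OF assms(1-3), of ?C] by simp
qed

subsection \<open>Pairs with a propositional second component\<close>

lemma has_MkPair_sub:
  assumes B_type: "is_type (A # \<Gamma>) B" and \<sigma>_has: "has_subst \<Delta> \<sigma> \<Gamma>"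
    and "\<Delta> \<turnstile> a \<Colon> sub \<sigma> A" and "\<Delta> \<turnstile> b \<Colon> sub (a \<bullet> \<sigma>) B"
  shows "\<Delta> \<turnstile> MkPair a b \<Colon> sub \<sigma> (SigT A B)"
proof -
  have "has_subst (sub \<sigma> A # \<Delta>) (ups \<sigma>) (A # \<Gamma>)"
    using sub_is_type[OF is_type_head_is_type[OF B_type] \<sigma>_has] \<sigma>_has by (simp add: has_subst_ups)
  moreover have "inst1 (sub (ups \<sigma>) B) a = sub (a \<bullet> \<sigma>) B"
    unfolding sub_sub sub_scons_comp_ups by (simp add: comp_def)
  ultimately show ?thesis
    using has_MkPair[OF sub_is_type[OF B_type] assms(3)] assms(4) by simp
qed

lemma has_MkPair_wk:
  assumes B_type: "is_type (A # \<Gamma>) B" and a_has: "\<Gamma> \<turnstile> a \<Colon> A"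
  shows "inst1 B a # \<Gamma> \<turnstile> MkPair (wk a) (Var 0) \<Colon> wk (SigT A B)"
proof -
  note Ba_type = inst1_is_type[OF B_type a_has]
  have "sub (wk a \<bullet> (\<lambda>k. Var (Suc k))) B = wk (inst1 B a)"
    unfolding ren_eq_sub sub_sub sub_comp_scons by (simp add: comp_def)
  then have "inst1 B a # \<Gamma> \<turnstile> MkPair (wk a) (Var 0) \<Colon> sub (\<lambda>k. Var (Suc k)) (SigT A B)"
    using weaken_has[OF a_has] Ba_type
    by (intro has_MkPair_sub[OF B_type has_subst_wk]) (simp_all add: sub_Var_Suc)
  then show ?thesis
    by (simp only: sub_Var_Suc)
qed

lemma has_MkPair_wk_wk:
  assumes B_type: "is_type (A # \<Gamma>) B"
  shows "B # A # \<Gamma> \<turnstile> MkPair (Var 1) (Var 0) \<Colon> wk (wk (SigT A B))"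
proof -
  have "Var (Suc 0) \<bullet> (\<lambda>k. Var (Suc (Suc k))) = (\<lambda>k. Var (Suc k))"
    by (rule ext) (simp add: scons_def split: nat.split)
  then have "B # A # \<Gamma> \<turnstile> MkPair (Var 1) (Var 0) \<Colon> sub (\<lambda>k. Var (Suc (Suc k))) (SigT A B)"
    using B_type
    by (intro has_MkPair_sub[OF B_type has_subst_wk_wk]) (simp_all add: sub_Var_Suc sub_Var_Suc_Suc)
  then show ?thesis
    by (simp only: sub_Var_Suc_Suc)
qed

lemma inhabited_MkPair_cong:
  assumes "\<Gamma> \<tturnstile> IdT (inst1 B a) b c" and "\<Gamma> \<turnstile> b \<Colon> inst1 B a" and "\<Gamma> \<turnstile> c \<Colon> inst1 B a"
    and a_has: "\<Gamma> \<turnstile> a \<Colon> A" and B_type: "is_type (A # \<Gamma>) B"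
  shows "\<Gamma> \<tturnstile> IdT (SigT A B) (MkPair a b) (MkPair a c)"
  using inhabited_cong[OF assms(1-3) has_MkPair_wk[OF B_type a_has]] B_type
    is_type_head_is_type[OF B_type] by simp

lemma inhabited_MkPair_prop_cong:
  assumes "A # \<Gamma> \<tturnstile> isProp B" and B_type: "is_type (A # \<Gamma>) B"
    and a_has: "\<Gamma> \<turnstile> a \<Colon> A" and b_has: "\<Gamma> \<turnstile> b \<Colon> inst1 B a"
  shows "\<Gamma> \<tturnstile> PiT (inst1 B a) (IdT (wk (SigT A B)) (wk (MkPair a b)) (MkPair (wk a) (Var 0)))"
proof (rule inhabited_PiI)
  let ?\<Delta> = "inst1 B a # \<Gamma>" and ?B = "ren (upr Suc) B"
  note A_type = is_type_head_is_type[OF B_type] and Ba_type = inst1_is_type[OF B_type a_has]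
  have wk_Ba: "inst1 ?B (wk a) = wk (inst1 B a)"
    by (simp only: ren_eq_sub sub_inst ups_Var_comp)
  have "ren (upr Suc) B = sub (ups (\<lambda>k. Var (Suc k))) B"
    using ups_Var_comp[of Suc] by (simp add: ren_eq_sub comp_def)
  then have wk_B_type: "is_type (wk A # ?\<Delta>) ?B"
    using sub_is_type[OF B_type has_subst_ups[OF has_subst_wk, of "inst1 B a" \<Gamma> A]] A_type Ba_type
    by (simp add: sub_Var_Suc)
  have "?\<Delta> \<tturnstile> isProp (wk (inst1 B a))"
    using weaken_inhabited[OF inhabited_inst1[OF assms(1) a_has] Ba_type] by simp
  then have "?\<Delta> \<tturnstile> IdT (inst1 ?B (wk a)) (wk b) (Var 0)"
    unfolding wk_Ba using weaken_has[OF b_has] Ba_type by (intro inhabited_isPropE) simp_all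
  from inhabited_MkPair_cong[OF this _ _ _ wk_B_type]
  show "?\<Delta> \<tturnstile> IdT (wk (SigT A B)) (wk (MkPair a b)) (MkPair (wk a) (Var 0))"
    using weaken_has[OF a_has] weaken_has[OF b_has] Ba_type by (simp add: wk_Ba)
qed

lemma inhabited_MkPair_eqI:
  assumes "\<Gamma> \<tturnstile> IdT A a a'" and "A # \<Gamma> \<tturnstile> isProp B" and B_type: "is_type (A # \<Gamma>) B"
    and a_has: "\<Gamma> \<turnstile> a \<Colon> A" and b_has: "\<Gamma> \<turnstile> b \<Colon> inst1 B a"
    and a'_has: "\<Gamma> \<turnstile> a' \<Colon> A" and b'_has: "\<Gamma> \<turnstile> b' \<Colon> inst1 B a'"
  shows "\<Gamma> \<tturnstile> IdT (SigT A B) (MkPair a b) (MkPair a' b')"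
proof -
  let ?S = "SigT A B" and ?u = "MkPair a b"
  let ?C = "PiT B (IdT (wk (wk ?S)) (wk (wk ?u)) (MkPair (Var 1) (Var 0)))"
  note A_type = is_type_head_is_type[OF B_type]
  have "is_type (B # A # \<Gamma>) (wk (wk ?S))"
    using weaken_is_type[OF weaken_is_type[OF is_type_Sig[OF A_type B_type] A_type] B_type] .
  then have C_type: "is_type (A # \<Gamma>) ?C"
    using weaken_has[OF weaken_has[OF has_MkPair[OF B_type a_has b_has]]]
      has_MkPair_wk_wk[OF B_type] A_type B_type by (intro is_type_Pi is_type_Id) simp_all
  have "\<Gamma> \<tturnstile> inst1 ?C a"
    using inhabited_MkPair_prop_cong[OF assms(2) B_type a_has b_has] by (simp del: ren.simps)
  from inhabited_transport[OF assms(1) a_has a'_has C_type this]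
  have "\<Gamma> \<tturnstile> PiT (inst1 B a') (IdT (wk ?S) (wk ?u) (MkPair (wk a') (Var 0)))"
    by (simp del: ren.simps)
  from inhabited_PiE[OF this b'_has] show ?thesis
    by (simp del: ren.simps)
qed

lemma inhabited_Sig_eqI:
  assumes "\<Gamma> \<tturnstile> IdT A (Fst u) (Fst v)" and "A # \<Gamma> \<tturnstile> isProp B" and B_type: "is_type (A # \<Gamma>) B"
    and u_has: "\<Gamma> \<turnstile> u \<Colon> SigT A B" and v_has: "\<Gamma> \<turnstile> v \<Colon> SigT A B"
  shows "\<Gamma> \<tturnstile> IdT (SigT A B) u v"
proof -
  let ?eta = "\<lambda>u. MkPair (Fst u) (Snd u)"
  obtain i where "\<Gamma> \<turnstile> SigT A B \<Colon> Univ i"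
    using is_type_Sig[OF is_type_head_is_type[OF B_type] B_type] by (auto simp: is_type_def)
  then have "\<Gamma> \<turnstile> IdT (SigT A B) u v \<doteq> IdT (SigT A B) (?eta u) (?eta v) \<Colon> Univ i"
    by (intro Id_F_C Eq_refl Sig_eta u_has v_has)
  moreover have "\<Gamma> \<tturnstile> IdT (SigT A B) (?eta u) (?eta v)"
    using assms(1-3) Fst_E[OF u_has] Snd_E[OF u_has] Fst_E[OF v_has] Snd_E[OF v_has]
    by (rule inhabited_MkPair_eqI)
  ultimately show ?thesis
    by (blast intro: inhabited_conv Eq_sym)
qed

section \<open>Booleans\<close>

abbreviation holds :: "tm \<Rightarrow> tm" where
  "holds b \<equiv> IdT TwoT b Two1"

abbreviation fails :: "tm \<Rightarrow> tm" where
  "fails b \<equiv> IdT TwoT b Two0"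

lemma is_type_holds [simp]: "\<Gamma> \<turnstile> b \<Colon> TwoT \<Longrightarrow> is_type \<Gamma> (holds b)"
  using has_ctx[of \<Gamma> b] by simp

lemma inhabited_holds_jeq:
  assumes "\<Gamma> \<turnstile> b \<doteq> c \<Colon> TwoT"
  shows "\<Gamma> \<tturnstile> holds b \<longleftrightarrow> \<Gamma> \<tturnstile> holds c"
proof -
  have "\<Gamma> \<turnstile> holds b \<doteq> holds c \<Colon> Univ 0"
    using jeq_ctx[OF assms] assms by (intro Id_F_C Eq_refl Two_F) simp_all
  then show ?thesis
    using Eq_sym inhabited_conv by blast
qed

lemma inhabited_bit_cases:
  assumes b_has: "\<Gamma> \<turnstile> b \<Colon> TwoT" and R_type: "is_type \<Gamma> R"
    and "fails b # \<Gamma> \<tturnstile> wk R" and "holds b # \<Gamma> \<tturnstile> wk R"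
  shows "\<Gamma> \<tturnstile> R"
proof -
  let ?C = "IdT TwoT (wk b) (Var 0) \<rightarrow>\<^sub>t wk R"
  have "is_type (TwoT # \<Gamma>) ?C"
    using b_has R_type has_ctx[OF b_has] by simp
  moreover have "\<Gamma> \<tturnstile> inst1 ?C Two0" and "\<Gamma> \<tturnstile> inst1 ?C Two1"
    using assms(3,4) by (simp_all add: inhabited_ArrI)
  ultimately have "\<Gamma> \<tturnstile> inst1 ?C b"
    using b_has by (rule inhabited_Two_induct)
  then show ?thesis
    using inhabited_ArrE inhabited_refl[OF b_has] by simp
qed

text \<open>By transport in the family with fibre \<open>UnitT\<close> over 0 and \<open>R\<close> over 1.\<close>

lemma inhabited_absurd:
  assumes "\<Gamma> \<tturnstile> IdT TwoT Two0 Two1" and "is_type \<Gamma> R"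
  shows "\<Gamma> \<tturnstile> R"
proof -
  note ctx = inhabited_ctx[OF assms(1)]
  obtain i where R_has: "\<Gamma> \<turnstile> R \<Colon> Univ i"
    using assms(2) by (auto simp: is_type_def)
  let ?F = "\<lambda>b. TwoInd (Univ i) UnitT R b"
  have fibre_has: "TwoT # \<Gamma> \<turnstile> TwoInd (Univ i) UnitT (wk R) (Var 0) \<Colon> Univ i"
    using Two_E[of "TwoT # \<Gamma>" "Univ i" "Suc i" UnitT "wk R" "Var 0"] weaken_has[OF R_has, of TwoT] ctx
    by (simp add: Univ_F Unit_F)
  have "\<Gamma> \<turnstile> ?F Two0 \<doteq> UnitT \<Colon> Univ i"
    using Two0_beta[of \<Gamma> "Univ i" "Suc i" UnitT R] R_has ctx by (simp add: Univ_F Unit_F)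
  then have "\<Gamma> \<tturnstile> ?F Two0"
    using Eq_sym inhabited_conv has_inhabited[OF Unit_I[OF ctx]] by blast
  then have "\<Gamma> \<tturnstile> ?F Two1"
    using inhabited_transport[OF assms(1) _ _ has_Univ_is_type[OF fibre_has]] ctx by simp
  moreover have "\<Gamma> \<turnstile> ?F Two1 \<doteq> R \<Colon> Univ i"
    using Two1_beta[of \<Gamma> "Univ i" "Suc i" UnitT R] R_has ctx by (simp add: Univ_F Unit_F)
  ultimately show ?thesis
    by (rule inhabited_conv)
qed

lemma inhabited_contradiction:
  assumes "\<Gamma> \<tturnstile> fails b" and "\<Gamma> \<tturnstile> holds b" and b_has: "\<Gamma> \<turnstile> b \<Colon> TwoT" and R_type: "is_type \<Gamma> R"
  shows "\<Gamma> \<tturnstile> R"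
proof (rule inhabited_absurd[OF _ R_type])
  note ctx = has_ctx[OF b_has]
  have "\<Gamma> \<tturnstile> IdT TwoT Two0 b"
    using inhabited_sym[OF assms(1) b_has] ctx by simp
  then show "\<Gamma> \<tturnstile> IdT TwoT Two0 Two1"
    using inhabited_trans[OF _ assms(2)] b_has ctx by simp
qed

lemma inhabited_Trunc_holds_Arr:
  assumes "holds b # \<Gamma> \<tturnstile> Trunc (wk A)" and b_has: "\<Gamma> \<turnstile> b \<Colon> TwoT" and A_type: "is_type \<Gamma> A"
  shows "\<Gamma> \<tturnstile> Trunc (holds b \<rightarrow>\<^sub>t A)"
proof (rule inhabited_bit_cases[OF b_has])
  note ctx = has_ctx[OF b_has]
  have "holds (wk b) # fails b # \<Gamma> \<tturnstile> wk (wk A)"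
    using inhabited_contradiction[of "holds (wk b) # fails b # \<Gamma>" "wk (wk b)" "wk (wk A)"]
      inhabited_second[of "fails b" \<Gamma> "holds (wk b)"] inhabited_head[of "fails b # \<Gamma>" "holds (wk b)"]
      A_type b_has ctx by simp
  then show "fails b # \<Gamma> \<tturnstile> wk (Trunc (holds b \<rightarrow>\<^sub>t A))"
    by (simp add: inhabited_TruncI inhabited_ArrI)
next
  note ctx = has_ctx[OF b_has]
  have "wk A # holds b # \<Gamma> \<tturnstile> holds (wk (wk b)) \<rightarrow>\<^sub>t wk (wk A)"
    using inhabited_Arr_const[OF inhabited_head[of "holds b # \<Gamma>" "wk A"], of "holds (wk (wk b))"]
      A_type b_has ctx by simp
  then show "holds b # \<Gamma> \<tturnstile> wk (Trunc (holds b \<rightarrow>\<^sub>t A))"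
    using inhabited_Trunc_map[OF assms(1), of "holds (wk b) \<rightarrow>\<^sub>t wk A"] A_type b_has ctx by simp
qed (use A_type b_has has_ctx[OF b_has] in simp)

subsection \<open>Conjunction with a negated boolean\<close>

definition and_not :: "tm \<Rightarrow> tm \<Rightarrow> tm" where
  "and_not b c = TwoInd TwoT b Two0 c"

lemma ren_and_not [simp]: "ren \<rho> (and_not b c) = and_not (ren \<rho> b) (ren \<rho> c)"
  and sub_and_not [simp]: "sub \<sigma> (and_not b c) = and_not (sub \<sigma> b) (sub \<sigma> c)"
  by (simp_all add: and_not_def)

lemma has_and_not [simp]: "\<Gamma> \<turnstile> b \<Colon> TwoT \<Longrightarrow> \<Gamma> \<turnstile> c \<Colon> TwoT \<Longrightarrow> \<Gamma> \<turnstile> and_not b c \<Colon> TwoT"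
  using Two_E[of \<Gamma> TwoT 0 b Two0 c] has_ctx[of \<Gamma> b] by (simp add: and_not_def Two_F)

lemma and_not_cong:
  assumes "\<Gamma> \<turnstile> b \<doteq> b' \<Colon> TwoT" and "\<Gamma> \<turnstile> c \<Colon> TwoT"
  shows "\<Gamma> \<turnstile> and_not b c \<doteq> and_not b' c \<Colon> TwoT"
  using Two_E_C[of \<Gamma> TwoT TwoT 0 b b' Two0 Two0 c c] has_ctx[OF assms(2)] assms
  by (simp add: and_not_def Two_F Eq_refl)

lemma and_not_Two0: "\<Gamma> \<turnstile> b \<Colon> TwoT \<Longrightarrow> \<Gamma> \<turnstile> and_not b Two0 \<doteq> b \<Colon> TwoT"
  using Two0_beta[of \<Gamma> TwoT 0 b Two0] has_ctx[of \<Gamma> b] by (simp add: and_not_def Two_F)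

lemma and_not_Two1: "\<Gamma> \<turnstile> b \<Colon> TwoT \<Longrightarrow> \<Gamma> \<turnstile> and_not b Two1 \<doteq> Two0 \<Colon> TwoT"
  using Two1_beta[of \<Gamma> TwoT 0 b Two0] has_ctx[of \<Gamma> b] by (simp add: and_not_def Two_F)

lemma inhabited_holds_and_not_transport:
  assumes "\<Gamma> \<tturnstile> IdT TwoT c d" and "\<Gamma> \<tturnstile> holds (and_not b c)"
    and "\<Gamma> \<turnstile> b \<Colon> TwoT" and "\<Gamma> \<turnstile> c \<Colon> TwoT" and "\<Gamma> \<turnstile> d \<Colon> TwoT"
  shows "\<Gamma> \<tturnstile> holds (and_not b d)"
  using inhabited_transport[of \<Gamma> TwoT c d "holds (and_not (wk b) (Var 0))"] assms has_ctx[OF assms(3)]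
  by simp

lemma inhabited_holds_and_notI:
  assumes "\<Gamma> \<tturnstile> holds b" and "\<Gamma> \<tturnstile> fails c" and b_has: "\<Gamma> \<turnstile> b \<Colon> TwoT" and c_has: "\<Gamma> \<turnstile> c \<Colon> TwoT"
  shows "\<Gamma> \<tturnstile> holds (and_not b c)"
proof -
  note ctx = has_ctx[OF b_has]
  have "\<Gamma> \<tturnstile> IdT TwoT Two0 c"
    using inhabited_sym[OF assms(2) c_has] ctx by simp
  moreover have "\<Gamma> \<tturnstile> holds (and_not b Two0)"
    using inhabited_holds_jeq[OF and_not_Two0] assms(1) b_has by blast
  ultimately show ?thesis
    using b_has has_Two0[OF ctx] c_has by (rule inhabited_holds_and_not_transport)
qed

lemma inhabited_and_not_disjoint:
  assumes "\<Gamma> \<tturnstile> holds (and_not b c)" and "\<Gamma> \<tturnstile> holds c"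
    and b_has: "\<Gamma> \<turnstile> b \<Colon> TwoT" and c_has: "\<Gamma> \<turnstile> c \<Colon> TwoT" and R_type: "is_type \<Gamma> R"
  shows "\<Gamma> \<tturnstile> R"
proof (rule inhabited_absurd[OF _ R_type])
  have "\<Gamma> \<tturnstile> holds (and_not b Two1)"
    using assms(2,1) b_has c_has has_Two1[OF has_ctx[OF b_has]]
    by (rule inhabited_holds_and_not_transport)
  then show "\<Gamma> \<tturnstile> holds Two0"
    using inhabited_holds_jeq[OF and_not_Two1] b_has by blast
qed

lemma inhabited_holds_and_notD:
  assumes "\<Gamma> \<tturnstile> holds (and_not b c)" and b_has: "\<Gamma> \<turnstile> b \<Colon> TwoT" and c_has: "\<Gamma> \<turnstile> c \<Colon> TwoT"
  shows "\<Gamma> \<tturnstile> holds b"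
proof (rule inhabited_bit_cases[OF c_has])
  note ctx = has_ctx[OF b_has]
  have "fails c # \<Gamma> \<tturnstile> holds (and_not (wk b) (wk c))"
    using weaken_inhabited[OF assms(1)] c_has ctx by simp
  then have "fails c # \<Gamma> \<tturnstile> holds (and_not (wk b) Two0)"
    using inhabited_holds_and_not_transport[of "fails c # \<Gamma>" "wk c" Two0 "wk b"]
      inhabited_head[of \<Gamma> "fails c"] b_has c_has ctx by simp
  then show "fails c # \<Gamma> \<tturnstile> wk (holds b)"
    using inhabited_holds_jeq[OF and_not_Two0] b_has c_has ctx by simp
next
  note ctx = has_ctx[OF b_has]
  show "holds c # \<Gamma> \<tturnstile> wk (holds b)"
    using inhabited_and_not_disjoint[of "holds c # \<Gamma>" "wk b" "wk c" "holds (wk b)"]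
      weaken_inhabited[OF assms(1)] inhabited_head[of \<Gamma> "holds c"] b_has c_has ctx by simp
qed (use b_has has_ctx[OF b_has] in simp)

subsection \<open>Equations between booleans are propositions\<close>

abbreviation paths_from_Two1 :: "tm \<Rightarrow> tm" where
  "paths_from_Two1 b \<equiv> IdT TwoT Two1 b"

text \<open>An endomap of the paths out of 1 that is constant over the end point 1, by computation, and the
  identity, by path induction; so every loop at 1 is reflexivity. Path induction applies because the end
  point varies.\<close>

definition collapse :: "tm \<Rightarrow> tm" where
  "collapse b = TwoInd (paths_from_Two1 (Var 0) \<rightarrow>\<^sub>t paths_from_Two1 (Var 0))
    (Lam (paths_from_Two1 Two0) (Var 0)) (Lam (paths_from_Two1 Two1) (Refl Two1)) b"

lemma ren_collapse [simp]: "ren \<rho> (collapse b) = collapse (ren \<rho> b)"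
  and sub_collapse [simp]: "sub \<sigma> (collapse b) = collapse (sub \<sigma> b)"
  by (simp_all add: collapse_def)

lemma has_collapse_motive:
  assumes "\<turnstile> \<Gamma>"
  shows "TwoT # \<Gamma> \<turnstile> paths_from_Two1 (Var 0) \<rightarrow>\<^sub>t paths_from_Two1 (Var 0) \<Colon> Univ 0"
  using assms by (auto simp: Arr_def Two_F intro!: Pi_F Id_F)

lemma has_collapse_branches:
  assumes "\<turnstile> \<Gamma>"
  shows "\<Gamma> \<turnstile> Lam (paths_from_Two1 Two0) (Var 0) \<Colon> paths_from_Two1 Two0 \<rightarrow>\<^sub>t paths_from_Two1 Two0"
    and "\<Gamma> \<turnstile> Lam (paths_from_Two1 Two1) (Refl Two1) \<Colon> paths_from_Two1 Two1 \<rightarrow>\<^sub>t paths_from_Two1 Two1"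
  using assms by (auto intro!: has_Lam_Arr)

lemma has_collapse: "\<Gamma> \<turnstile> b \<Colon> TwoT \<Longrightarrow> \<Gamma> \<turnstile> collapse b \<Colon> paths_from_Two1 b \<rightarrow>\<^sub>t paths_from_Two1 b"
  using Two_E[OF has_collapse_motive] has_collapse_branches has_ctx[of \<Gamma> b] by (simp add: collapse_def)

lemma App_collapse_Two1:
  assumes "\<Gamma> \<turnstile> p \<Colon> paths_from_Two1 Two1"
  shows "\<Gamma> \<turnstile> App (collapse Two1) p \<doteq> Refl Two1 \<Colon> paths_from_Two1 Two1"
proof (rule Eq_trans)
  note ctx = has_ctx[OF assms]
  let ?const = "Lam (paths_from_Two1 Two1) (Refl Two1)"
  have "\<Gamma> \<turnstile> collapse Two1 \<doteq> ?const \<Colon> paths_from_Two1 Two1 \<rightarrow>\<^sub>t paths_from_Two1 Two1"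
    using Two1_beta[OF has_collapse_motive[OF ctx]] has_collapse_branches[OF ctx]
    by (simp add: collapse_def)
  then show "\<Gamma> \<turnstile> App (collapse Two1) p \<doteq> App ?const p \<Colon> paths_from_Two1 Two1"
    using assms by (rule App_Arr_cong)
  show "\<Gamma> \<turnstile> App ?const p \<doteq> Refl Two1 \<Colon> paths_from_Two1 Two1"
    using App_Lam_Arr[of "paths_from_Two1 Two1" \<Gamma> "Refl Two1" "paths_from_Two1 Two1" p] assms ctx by simp
qed

lemma inhabited_Refl_Two1_unique:
  assumes p_has: "\<Gamma> \<turnstile> p \<Colon> holds Two1"
  shows "\<Gamma> \<tturnstile> IdT (holds Two1) (Refl Two1) p"
proof -
  note ctx = has_ctx[OF p_has]
  have const: "\<Gamma> \<tturnstile> IdT (holds Two1) (Refl Two1) (App (collapse Two1) q)" if "\<Gamma> \<turnstile> q \<Colon> holds Two1" for q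
    using inhabited_Id_of_jeq[OF Eq_sym[OF App_collapse_Two1[OF that]]] ctx by simp
  let ?C = "IdT (paths_from_Two1 (Var 1)) (Var 0) (App (collapse (Var 1)) (Var 0))"
  have "is_type (paths_from_Two1 (Var 0) # TwoT # \<Gamma>) ?C"
    using ctx by (simp add: has_App_Arr[OF has_collapse])
  then have "\<Gamma> \<tturnstile> inst2 ?C Two1 p"
    using inhabited_J[of \<Gamma> p TwoT Two1 Two1 ?C] p_has ctx const[of "Refl Two1"] by simp
  then have "\<Gamma> \<tturnstile> IdT (holds Two1) (App (collapse Two1) p) p"
    using inhabited_sym[of \<Gamma> _ p "App (collapse Two1) p"] p_has has_collapse[of \<Gamma> Two1] ctx
    by (simp add: has_App_Arr)
  then show ?thesis
    using inhabited_trans[OF const[OF p_has]] p_has has_collapse[of \<Gamma> Two1] ctx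
    by (simp add: has_App_Arr)
qed

lemma inhabited_isProp_holds:
  assumes b_has: "\<Gamma> \<turnstile> b \<Colon> TwoT"
  shows "\<Gamma> \<tturnstile> isProp (holds b)"
proof -
  note ctx = has_ctx[OF b_has]
  have "\<Gamma> \<tturnstile> isProp (holds Two0)"
  proof (rule inhabited_isPropI)
    let ?\<Delta> = "holds Two0 # holds Two0 # \<Gamma>"
    have "?\<Delta> \<tturnstile> holds Two0"
      using inhabited_head[of "holds Two0 # \<Gamma>" "holds Two0"] ctx by simp
    then show "wk (holds Two0) # holds Two0 # \<Gamma> \<tturnstile> IdT (wk (wk (holds Two0))) (Var 1) (Var 0)"
      using inhabited_absurd[of ?\<Delta> "IdT (holds Two0) (Var 1) (Var 0)"] ctx by simp
  qed
  moreover have "\<Gamma> \<tturnstile> isProp (holds Two1)"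
  proof (rule inhabited_isPropI)
    let ?\<Delta> = "holds Two1 # holds Two1 # \<Gamma>"
    have vars_has: "?\<Delta> \<turnstile> Var 1 \<Colon> holds Two1" "?\<Delta> \<turnstile> Var 0 \<Colon> holds Two1"
      using ctx by simp_all
    have "?\<Delta> \<tturnstile> IdT (holds Two1) (Var 1) (Refl Two1)"
      using inhabited_sym[OF inhabited_Refl_Two1_unique[OF vars_has(1)]] vars_has ctx by simp
    then show "wk (holds Two1) # holds Two1 # \<Gamma> \<tturnstile> IdT (wk (wk (holds Two1))) (Var 1) (Var 0)"
      using inhabited_trans[OF _ inhabited_Refl_Two1_unique[OF vars_has(2)]] vars_has ctx by simp
  qed
  ultimately show ?thesis
    using inhabited_Two_induct[of \<Gamma> "isProp (holds (Var 0))" b] b_has ctx by simp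
qed

section \<open>Sequences and the types \<open>\<langle>\<alpha>\<rangle>\<close>\<close>

abbreviation SeqT :: tm where
  "SeqT \<equiv> NatT \<rightarrow>\<^sub>t TwoT"

lemma weaken_has_Seq [simp]: "\<Gamma> \<turnstile> \<alpha> \<Colon> SeqT \<Longrightarrow> is_type \<Gamma> A \<Longrightarrow> A # \<Gamma> \<turnstile> wk \<alpha> \<Colon> SeqT"
  using weaken_has[of \<Gamma> \<alpha> SeqT] by simp

lemma has_App_Seq [simp]: "\<Gamma> \<turnstile> \<alpha> \<Colon> SeqT \<Longrightarrow> \<Gamma> \<turnstile> n \<Colon> NatT \<Longrightarrow> \<Gamma> \<turnstile> App \<alpha> n \<Colon> TwoT"
  by (rule has_App_Arr)

lemma ren_isOne [simp]: "ren \<rho> (isOne \<alpha> n) = isOne (ren \<rho> \<alpha>) (ren \<rho> n)"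
  and sub_isOne [simp]: "sub \<sigma> (isOne \<alpha> n) = isOne (sub \<sigma> \<alpha>) (sub \<sigma> n)"
  by (simp_all add: isOne_def)

lemma ren_angle [simp]: "ren \<rho> (angle \<alpha>) = angle (ren \<rho> \<alpha>)"
  and sub_angle [simp]: "sub \<sigma> (angle \<alpha>) = angle (sub \<sigma> \<alpha>)"
  by (simp_all add: angle_def)

lemma is_type_isOne [simp]: "\<Gamma> \<turnstile> \<alpha> \<Colon> SeqT \<Longrightarrow> \<Gamma> \<turnstile> n \<Colon> NatT \<Longrightarrow> is_type \<Gamma> (isOne \<alpha> n)"
  by (simp add: isOne_def)

lemma angle_has:
  assumes "\<Gamma> \<turnstile> \<alpha> \<Colon> SeqT"
  shows "\<Gamma> \<turnstile> angle \<alpha> \<Colon> Univ i"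
  using assms has_ctx[OF assms] unfolding angle_def isOne_def by (intro Sig_F Id_F Nat_F Two_F) simp_all

lemma is_type_angle [simp]: "\<Gamma> \<turnstile> \<alpha> \<Colon> SeqT \<Longrightarrow> is_type \<Gamma> (angle \<alpha>)"
  by (rule has_Univ_is_type[OF angle_has])

lemma angle_cong:
  assumes "\<Gamma> \<turnstile> \<alpha> \<doteq> \<beta> \<Colon> SeqT"
  shows "\<Gamma> \<turnstile> angle \<alpha> \<doteq> angle \<beta> \<Colon> Univ i"
proof -
  note ctx = jeq_ctx[OF assms]
  have "NatT # \<Gamma> \<turnstile> wk \<alpha> \<doteq> wk \<beta> \<Colon> SeqT"
    using weaken_jeq[OF assms, of NatT] ctx by simp
  then have "NatT # \<Gamma> \<turnstile> App (wk \<alpha>) (Var 0) \<doteq> App (wk \<beta>) (Var 0) \<Colon> TwoT"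
    using ctx by (elim App_Arr_cong) simp_all
  then show ?thesis
    unfolding angle_def isOne_def using ctx by (intro Sig_F_C Id_F_C Eq_refl Nat_F Two_F) simp_all
qed

lemma has_Fst_angle: "\<Gamma> \<turnstile> u \<Colon> angle \<alpha> \<Longrightarrow> \<Gamma> \<turnstile> Fst u \<Colon> NatT"
  unfolding angle_def by (rule Fst_E)

lemma inhabited_isOne_Fst: "\<Gamma> \<turnstile> u \<Colon> angle \<alpha> \<Longrightarrow> \<Gamma> \<tturnstile> isOne \<alpha> (Fst u)"
  unfolding angle_def using has_inhabited[OF Snd_E] by fastforce

lemma inhabited_angleI:
  assumes "\<Gamma> \<turnstile> \<alpha> \<Colon> SeqT" and "\<Gamma> \<turnstile> n \<Colon> NatT" and "\<Gamma> \<tturnstile> isOne \<alpha> n"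
  shows "\<Gamma> \<tturnstile> angle \<alpha>"
  unfolding angle_def using assms has_ctx[OF assms(1)] by (intro inhabited_SigI[where a = n]) simp_all

lemma inhabited_angleE:
  assumes "\<Gamma> \<tturnstile> angle \<alpha>"
  obtains n where "\<Gamma> \<turnstile> n \<Colon> NatT" and "\<Gamma> \<tturnstile> isOne \<alpha> n"
  using assms unfolding angle_def by (auto elim: inhabited_SigE)

lemma inhabited_angle_eqI:
  assumes \<alpha>_has: "\<Gamma> \<turnstile> \<alpha> \<Colon> SeqT" and "\<Gamma> \<tturnstile> IdT NatT (Fst u) (Fst v)"
    and "\<Gamma> \<turnstile> u \<Colon> angle \<alpha>" and "\<Gamma> \<turnstile> v \<Colon> angle \<alpha>"
  shows "\<Gamma> \<tturnstile> IdT (angle \<alpha>) u v"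
proof -
  have "is_type (NatT # \<Gamma>) (isOne (wk \<alpha>) (Var 0))" and "NatT # \<Gamma> \<tturnstile> isProp (isOne (wk \<alpha>) (Var 0))"
    using \<alpha>_has has_ctx[OF \<alpha>_has] by (simp_all add: isOne_def inhabited_isProp_holds)
  then show ?thesis
    using assms unfolding angle_def by (intro inhabited_Sig_eqI)
qed

definition at_most_one :: "tm \<Rightarrow> tm" where
  "at_most_one \<alpha> = PiT NatT (PiT NatT
    (isOne (wk (wk \<alpha>)) (Var 1) \<rightarrow>\<^sub>t isOne (wk (wk \<alpha>)) (Var 0) \<rightarrow>\<^sub>t IdT NatT (Var 1) (Var 0)))"

lemma ren_at_most_one [simp]: "ren \<rho> (at_most_one \<alpha>) = at_most_one (ren \<rho> \<alpha>)"
  by (simp add: at_most_one_def)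

lemma inhabited_at_most_oneE:
  assumes "\<Gamma> \<tturnstile> at_most_one \<alpha>" and n_has: "\<Gamma> \<turnstile> n \<Colon> NatT" and m_has: "\<Gamma> \<turnstile> m \<Colon> NatT"
    and "\<Gamma> \<tturnstile> isOne \<alpha> n" and "\<Gamma> \<tturnstile> isOne \<alpha> m"
  shows "\<Gamma> \<tturnstile> IdT NatT n m"
proof -
  have "\<Gamma> \<tturnstile> PiT NatT (isOne (wk \<alpha>) (wk n) \<rightarrow>\<^sub>t isOne (wk \<alpha>) (Var 0) \<rightarrow>\<^sub>t IdT NatT (wk n) (Var 0))"
    using inhabited_PiE[OF assms(1)[unfolded at_most_one_def] n_has] by simp
  from inhabited_PiE[OF this m_has] have "\<Gamma> \<tturnstile> isOne \<alpha> n \<rightarrow>\<^sub>t isOne \<alpha> m \<rightarrow>\<^sub>t IdT NatT n m"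
    by simp
  then show ?thesis
    using assms(4,5) inhabited_ArrE by blast
qed

lemma inhabited_isProp_angle:
  assumes "\<Gamma> \<tturnstile> at_most_one \<alpha>" and \<alpha>_has: "\<Gamma> \<turnstile> \<alpha> \<Colon> SeqT"
  shows "\<Gamma> \<tturnstile> isProp (angle \<alpha>)"
proof (rule inhabited_isPropI)
  let ?\<Delta> = "angle (wk \<alpha>) # angle \<alpha> # \<Gamma>" and ?\<alpha> = "wk (wk \<alpha>)"
  have vars_has: "?\<Delta> \<turnstile> Var 1 \<Colon> angle ?\<alpha>" "?\<Delta> \<turnstile> Var 0 \<Colon> angle ?\<alpha>"
    using \<alpha>_has by simp_all
  have "?\<Delta> \<tturnstile> at_most_one ?\<alpha>"
    using weaken_inhabited[OF weaken_inhabited[OF assms(1)], of "angle \<alpha>" "angle (wk \<alpha>)"] \<alpha>_has by simp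
  then have "?\<Delta> \<tturnstile> IdT NatT (Fst (Var 1)) (Fst (Var 0))"
    using vars_has[THEN has_Fst_angle] vars_has[THEN inhabited_isOne_Fst]
    by (rule inhabited_at_most_oneE)
  then have "?\<Delta> \<tturnstile> IdT (angle ?\<alpha>) (Var 1) (Var 0)"
    using vars_has \<alpha>_has by (intro inhabited_angle_eqI) simp_all
  then show "wk (angle \<alpha>) # angle \<alpha> # \<Gamma> \<tturnstile> IdT (wk (wk (angle \<alpha>))) (Var 1) (Var 0)"
    by simp
qed

section \<open>Rosolini propositions\<close>

definition Rosolini_structure :: "nat \<Rightarrow> tm \<Rightarrow> tm" where
  "Rosolini_structure i P = SigT Ninf (IdT (Univ i) (wk P) (angle (Fst (Var 0))))"

lemma isRosolini_eq_Trunc: "isRosolini i P = Trunc (Rosolini_structure i P)"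
  by (simp add: isRosolini_def Rosolini_structure_def)

lemma ren_Ninf [simp]: "ren \<rho> Ninf = Ninf"
  and sub_Ninf [simp]: "sub \<sigma> Ninf = Ninf"
  by (simp_all add: Ninf_def)

lemma ren_Rosolini_structure [simp]: "ren \<rho> (Rosolini_structure i P) = Rosolini_structure i (ren \<rho> P)"
  and sub_Rosolini_structure [simp]: "sub \<sigma> (Rosolini_structure i P) = Rosolini_structure i (sub \<sigma> P)"
  by (simp_all add: Rosolini_structure_def)

lemma ren_isRosolini [simp]: "ren \<rho> (isRosolini i P) = isRosolini i (ren \<rho> P)"
  and sub_isRosolini [simp]: "sub \<sigma> (isRosolini i P) = isRosolini i (sub \<sigma> P)"
  by (simp_all add: isRosolini_eq_Trunc)

lemma is_type_Ninf [simp]: "\<turnstile> \<Gamma> \<Longrightarrow> is_type \<Gamma> Ninf"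
  by (simp add: Ninf_def)

lemma has_Fst_Ninf: "\<Gamma> \<turnstile> u \<Colon> Ninf \<Longrightarrow> \<Gamma> \<turnstile> Fst u \<Colon> SeqT"
  unfolding Ninf_def by (rule Fst_E)

lemma is_type_Rosolini_family:
  assumes "\<Gamma> \<turnstile> P \<Colon> Univ i"
  shows "is_type (Ninf # \<Gamma>) (IdT (Univ i) (wk P) (angle (Fst (Var 0))))"
  using assms has_ctx[OF assms] by (simp add: angle_has has_Fst_Ninf)

lemma is_type_Rosolini_structure [simp]: "\<Gamma> \<turnstile> P \<Colon> Univ i \<Longrightarrow> is_type \<Gamma> (Rosolini_structure i P)"
  unfolding Rosolini_structure_def using is_type_Rosolini_family has_ctx[of \<Gamma> P] by simp

lemma is_type_isRosolini [simp]: "\<Gamma> \<turnstile> P \<Colon> Univ i \<Longrightarrow> is_type \<Gamma> (isRosolini i P)"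
  by (simp add: isRosolini_eq_Trunc)

lemma inhabited_Rosolini_structureE:
  assumes "\<Gamma> \<tturnstile> Rosolini_structure i P"
  obtains \<alpha> where "\<Gamma> \<turnstile> \<alpha> \<Colon> SeqT" and "\<Gamma> \<tturnstile> IdT (Univ i) P (angle \<alpha>)"
  using assms unfolding Rosolini_structure_def by (auto elim!: inhabited_SigE dest: has_Fst_Ninf)

lemma inhabited_isRosolini_angle:
  assumes \<alpha>_has: "\<Gamma> \<turnstile> \<alpha> \<Colon> SeqT" and "\<Gamma> \<tturnstile> isProp (angle \<alpha>)"
  shows "\<Gamma> \<tturnstile> isRosolini i (angle \<alpha>)"
proof -
  note ctx = has_ctx[OF \<alpha>_has]
  obtain h where h_has: "\<Gamma> \<turnstile> h \<Colon> isProp (angle \<alpha>)"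
    using assms(2) by (auto simp: inhabited_def)
  have isProp_type: "is_type (SeqT # \<Gamma>) (isProp (angle (Var 0)))"
    using ctx by simp
  have u_has: "\<Gamma> \<turnstile> MkPair \<alpha> h \<Colon> Ninf"
    unfolding Ninf_def using isProp_type \<alpha>_has h_has by (intro has_MkPair) simp_all
  have "\<Gamma> \<turnstile> Fst (MkPair \<alpha> h) \<doteq> \<alpha> \<Colon> SeqT"
    using isProp_type \<alpha>_has h_has by (auto simp: is_type_def intro: Fst_beta)
  then have "\<Gamma> \<turnstile> angle \<alpha> \<doteq> angle (Fst (MkPair \<alpha> h)) \<Colon> Univ i"
    by (blast intro: angle_cong Eq_sym)
  then have "\<Gamma> \<tturnstile> IdT (Univ i) (angle \<alpha>) (angle (Fst (MkPair \<alpha> h)))"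
    using \<alpha>_has ctx by (intro inhabited_Id_of_jeq) (simp_all add: angle_has)
  then have "\<Gamma> \<tturnstile> Rosolini_structure i (angle \<alpha>)"
    unfolding Rosolini_structure_def
    using inhabited_SigI[OF is_type_Rosolini_family[OF angle_has[OF \<alpha>_has]] u_has] by simp
  then show ?thesis
    by (simp add: isRosolini_eq_Trunc inhabited_TruncI)
qed

section \<open>First occurrences\<close>

subsection \<open>The sequence of first occurrences\<close>

definition shift :: "tm \<Rightarrow> tm" where
  "shift \<alpha> = Lam NatT (App (wk \<alpha>) (Succ (Var 0)))"

text \<open>\<open>first \<alpha>\<close> is 1 exactly at the first place where \<open>\<alpha>\<close> is. The recursion varies \<open>\<alpha>\<close>: the
  value at \<open>n + 1\<close> is the value at \<open>n\<close> for the shifted sequence, unless \<open>\<alpha>\<close> is already 1 at 0.\<close>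

definition first_rec :: "tm \<Rightarrow> tm" where
  "first_rec n = NatInd (SeqT \<rightarrow>\<^sub>t TwoT) (Lam SeqT (App (Var 0) Zero))
    (Lam SeqT (and_not (App (Var 1) (shift (Var 0))) (App (Var 0) Zero))) n"

definition first :: "tm \<Rightarrow> tm" where
  "first \<alpha> = Lam NatT (App (first_rec (Var 0)) (wk \<alpha>))"

lemma ren_shift [simp]: "ren \<rho> (shift \<alpha>) = shift (ren \<rho> \<alpha>)"
  and sub_shift [simp]: "sub \<sigma> (shift \<alpha>) = shift (sub \<sigma> \<alpha>)"
  by (simp_all add: shift_def)

lemma ren_first_rec [simp]: "ren \<rho> (first_rec n) = first_rec (ren \<rho> n)"
  and sub_first_rec [simp]: "sub \<sigma> (first_rec n) = first_rec (sub \<sigma> n)"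
  by (simp_all add: first_rec_def)

lemma ren_first [simp]: "ren \<rho> (first \<alpha>) = first (ren \<rho> \<alpha>)"
  and sub_first [simp]: "sub \<sigma> (first \<alpha>) = first (sub \<sigma> \<alpha>)"
  by (simp_all add: first_def)

lemma has_App_Seq_Two [simp]: "\<Gamma> \<turnstile> f \<Colon> SeqT \<rightarrow>\<^sub>t TwoT \<Longrightarrow> \<Gamma> \<turnstile> \<alpha> \<Colon> SeqT \<Longrightarrow> \<Gamma> \<turnstile> App f \<alpha> \<Colon> TwoT"
  by (rule has_App_Arr)

lemma has_shift [simp]: "\<Gamma> \<turnstile> \<alpha> \<Colon> SeqT \<Longrightarrow> \<Gamma> \<turnstile> shift \<alpha> \<Colon> SeqT"
  unfolding shift_def using has_ctx[of \<Gamma> \<alpha>] by (intro has_Lam_Arr) simp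

lemma App_shift:
  assumes "\<Gamma> \<turnstile> \<alpha> \<Colon> SeqT" and "\<Gamma> \<turnstile> n \<Colon> NatT"
  shows "\<Gamma> \<turnstile> App (shift \<alpha>) n \<doteq> App \<alpha> (Succ n) \<Colon> TwoT"
  using App_Lam_Arr[of NatT \<Gamma> "App (wk \<alpha>) (Succ (Var 0))" TwoT n] assms has_ctx[OF assms(1)]
  by (simp add: shift_def)

lemma has_first_rec_motive: "\<turnstile> \<Gamma> \<Longrightarrow> NatT # \<Gamma> \<turnstile> SeqT \<rightarrow>\<^sub>t TwoT \<Colon> Univ 0"
  unfolding Arr_def by (auto intro!: Pi_F Nat_F Two_F)

lemma has_first_rec_branches:
  assumes "\<turnstile> \<Gamma>"
  shows "\<Gamma> \<turnstile> Lam SeqT (App (Var 0) Zero) \<Colon> SeqT \<rightarrow>\<^sub>t TwoT"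
    and "(SeqT \<rightarrow>\<^sub>t TwoT) # NatT # \<Gamma>
      \<turnstile> Lam SeqT (and_not (App (Var 1) (shift (Var 0))) (App (Var 0) Zero)) \<Colon> SeqT \<rightarrow>\<^sub>t TwoT"
  using assms by (auto intro!: has_Lam_Arr)

lemma has_first_rec [simp]: "\<Gamma> \<turnstile> n \<Colon> NatT \<Longrightarrow> \<Gamma> \<turnstile> first_rec n \<Colon> SeqT \<rightarrow>\<^sub>t TwoT"
  using Nat_E[OF has_first_rec_motive] has_first_rec_branches has_ctx[of \<Gamma> n]
  by (simp add: first_rec_def)

lemma App_first_rec_Zero:
  assumes "\<Gamma> \<turnstile> \<alpha> \<Colon> SeqT"
  shows "\<Gamma> \<turnstile> App (first_rec Zero) \<alpha> \<doteq> App \<alpha> Zero \<Colon> TwoT"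
proof (rule Eq_trans)
  note ctx = has_ctx[OF assms]
  have "\<Gamma> \<turnstile> first_rec Zero \<doteq> Lam SeqT (App (Var 0) Zero) \<Colon> SeqT \<rightarrow>\<^sub>t TwoT"
    using Zero_beta[OF has_first_rec_motive[OF ctx]] has_first_rec_branches[OF ctx]
    by (simp add: first_rec_def)
  then show "\<Gamma> \<turnstile> App (first_rec Zero) \<alpha> \<doteq> App (Lam SeqT (App (Var 0) Zero)) \<alpha> \<Colon> TwoT"
    using assms by (rule App_Arr_cong)
  show "\<Gamma> \<turnstile> App (Lam SeqT (App (Var 0) Zero)) \<alpha> \<doteq> App \<alpha> Zero \<Colon> TwoT"
    using App_Lam_Arr[of SeqT \<Gamma> "App (Var 0) Zero" TwoT \<alpha>] assms ctx by simp
qed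

lemma App_first_rec_Succ:
  assumes "\<Gamma> \<turnstile> \<alpha> \<Colon> SeqT" and "\<Gamma> \<turnstile> n \<Colon> NatT"
  shows "\<Gamma> \<turnstile> App (first_rec (Succ n)) \<alpha> \<doteq> and_not (App (first_rec n) (shift \<alpha>)) (App \<alpha> Zero) \<Colon> TwoT"
proof (rule Eq_trans)
  note ctx = has_ctx[OF assms(1)]
  let ?body = "and_not (App (first_rec (wk n)) (shift (Var 0))) (App (Var 0) Zero)"
  have "\<Gamma> \<turnstile> first_rec (Succ n) \<doteq> Lam SeqT ?body \<Colon> SeqT \<rightarrow>\<^sub>t TwoT"
    using Succ_beta[OF has_first_rec_motive[OF ctx], of "Lam SeqT (App (Var 0) Zero)"
        "Lam SeqT (and_not (App (Var 1) (shift (Var 0))) (App (Var 0) Zero))" n]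
      has_first_rec_branches[OF ctx] assms(2) by (simp add: first_rec_def)
  then show "\<Gamma> \<turnstile> App (first_rec (Succ n)) \<alpha> \<doteq> App (Lam SeqT ?body) \<alpha> \<Colon> TwoT"
    using assms(1) by (rule App_Arr_cong)
  have "SeqT # \<Gamma> \<turnstile> ?body \<Colon> TwoT"
    using assms(2) ctx by simp
  then show "\<Gamma> \<turnstile> App (Lam SeqT ?body) \<alpha> \<doteq> and_not (App (first_rec n) (shift \<alpha>)) (App \<alpha> Zero) \<Colon> TwoT"
    using App_Lam_Arr[of SeqT \<Gamma> ?body TwoT \<alpha>] assms(1) by simp
qed

lemma has_first [simp]: "\<Gamma> \<turnstile> \<alpha> \<Colon> SeqT \<Longrightarrow> \<Gamma> \<turnstile> first \<alpha> \<Colon> SeqT"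
  unfolding first_def using has_ctx[of \<Gamma> \<alpha>] by (auto intro!: has_Lam_Arr)

lemma App_first:
  assumes "\<Gamma> \<turnstile> \<alpha> \<Colon> SeqT" and "\<Gamma> \<turnstile> n \<Colon> NatT"
  shows "\<Gamma> \<turnstile> App (first \<alpha>) n \<doteq> App (first_rec n) \<alpha> \<Colon> TwoT"
  using App_Lam_Arr[of NatT \<Gamma> "App (first_rec (Var 0)) (wk \<alpha>)" TwoT n] assms has_ctx[OF assms(1)]
  by (simp add: first_def)

lemma App_first_Zero: "\<Gamma> \<turnstile> \<alpha> \<Colon> SeqT \<Longrightarrow> \<Gamma> \<turnstile> App (first \<alpha>) Zero \<doteq> App \<alpha> Zero \<Colon> TwoT"
  using App_first App_first_rec_Zero has_ctx by (blast intro: Eq_trans Zero_I)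

lemma App_first_Succ:
  assumes "\<Gamma> \<turnstile> \<alpha> \<Colon> SeqT" and "\<Gamma> \<turnstile> n \<Colon> NatT"
  shows "\<Gamma> \<turnstile> App (first \<alpha>) (Succ n) \<doteq> and_not (App (first (shift \<alpha>)) n) (App \<alpha> Zero) \<Colon> TwoT"
proof (rule Eq_trans[OF _ Eq_trans])
  show "\<Gamma> \<turnstile> App (first \<alpha>) (Succ n) \<doteq> App (first_rec (Succ n)) \<alpha> \<Colon> TwoT"
    using assms by (simp add: App_first)
  show "\<Gamma> \<turnstile> App (first_rec (Succ n)) \<alpha> \<doteq> and_not (App (first_rec n) (shift \<alpha>)) (App \<alpha> Zero) \<Colon> TwoT"
    using assms by (rule App_first_rec_Succ)
  show "\<Gamma> \<turnstile> and_not (App (first_rec n) (shift \<alpha>)) (App \<alpha> Zero)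
      \<doteq> and_not (App (first (shift \<alpha>)) n) (App \<alpha> Zero) \<Colon> TwoT"
    using assms has_ctx[OF assms(1)] by (intro and_not_cong Eq_sym[OF App_first]) simp_all
qed

lemma inhabited_isOne_shift_iff:
  assumes "\<Gamma> \<turnstile> \<alpha> \<Colon> SeqT" and "\<Gamma> \<turnstile> n \<Colon> NatT"
  shows "\<Gamma> \<tturnstile> isOne (shift \<alpha>) n \<longleftrightarrow> \<Gamma> \<tturnstile> isOne \<alpha> (Succ n)"
  unfolding isOne_def using assms by (intro inhabited_holds_jeq App_shift)

lemma inhabited_isOne_first_Zero_iff:
  assumes "\<Gamma> \<turnstile> \<alpha> \<Colon> SeqT"
  shows "\<Gamma> \<tturnstile> isOne (first \<alpha>) Zero \<longleftrightarrow> \<Gamma> \<tturnstile> isOne \<alpha> Zero"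
  unfolding isOne_def using assms by (intro inhabited_holds_jeq App_first_Zero)

lemma inhabited_isOne_first_Succ_iff:
  assumes "\<Gamma> \<turnstile> \<alpha> \<Colon> SeqT" and "\<Gamma> \<turnstile> n \<Colon> NatT"
  shows "\<Gamma> \<tturnstile> isOne (first \<alpha>) (Succ n) \<longleftrightarrow> \<Gamma> \<tturnstile> holds (and_not (App (first (shift \<alpha>)) n) (App \<alpha> Zero))"
  unfolding isOne_def using assms by (intro inhabited_holds_jeq App_first_Succ)

lemma inhabited_isOne_first_SuccD:
  assumes "\<Gamma> \<tturnstile> isOne (first \<alpha>) (Succ n)" and "\<Gamma> \<turnstile> \<alpha> \<Colon> SeqT" and "\<Gamma> \<turnstile> n \<Colon> NatT"
  shows "\<Gamma> \<tturnstile> isOne (first (shift \<alpha>)) n"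
proof -
  have "\<Gamma> \<tturnstile> holds (and_not (App (first (shift \<alpha>)) n) (App \<alpha> Zero))"
    using assms by (simp add: inhabited_isOne_first_Succ_iff)
  then show ?thesis
    unfolding isOne_def using assms(2,3) has_ctx[OF assms(2)] by (elim inhabited_holds_and_notD) simp_all
qed

lemma inhabited_isOne_first_disjoint:
  assumes "\<Gamma> \<tturnstile> isOne (first \<alpha>) (Succ n)" and "\<Gamma> \<tturnstile> isOne (first \<alpha>) Zero"
    and "\<Gamma> \<turnstile> \<alpha> \<Colon> SeqT" and "\<Gamma> \<turnstile> n \<Colon> NatT" and "is_type \<Gamma> R"
  shows "\<Gamma> \<tturnstile> R"
proof (rule inhabited_and_not_disjoint)
  show "\<Gamma> \<tturnstile> holds (and_not (App (first (shift \<alpha>)) n) (App \<alpha> Zero))"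
    using assms(1,3,4) by (simp add: inhabited_isOne_first_Succ_iff)
  show "\<Gamma> \<tturnstile> holds (App \<alpha> Zero)"
    using assms(2,3) by (simp add: inhabited_isOne_first_Zero_iff flip: isOne_def)
qed (use assms(3-) has_ctx[OF assms(3)] in simp_all)

subsection \<open>Induction on a place, generalised over the sequence\<close>

text \<open>A family given by a function on terms that commutes with substitution can be used in every context;
  this hides the de Bruijn indices from the inductions that follow.\<close>

lemma inhabited_shift_induct:
  assumes sub_D: "\<And>\<sigma> n \<alpha>. sub \<sigma> (D n \<alpha>) = D (sub \<sigma> n) (sub \<sigma> \<alpha>)"
    and D_type: "\<And>\<Gamma> n \<alpha>. \<Gamma> \<turnstile> n \<Colon> NatT \<Longrightarrow> \<Gamma> \<turnstile> \<alpha> \<Colon> SeqT \<Longrightarrow> is_type \<Gamma> (D n \<alpha>)"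
    and Zero: "\<And>\<Gamma> \<alpha>. \<Gamma> \<turnstile> \<alpha> \<Colon> SeqT \<Longrightarrow> \<Gamma> \<tturnstile> D Zero \<alpha>"
    and Succ: "\<And>\<Gamma> n \<alpha>. \<Gamma> \<turnstile> n \<Colon> NatT \<Longrightarrow> \<Gamma> \<turnstile> \<alpha> \<Colon> SeqT \<Longrightarrow> \<Gamma> \<tturnstile> D n (shift \<alpha>) \<Longrightarrow> \<Gamma> \<tturnstile> D (Succ n) \<alpha>"
    and n_has: "\<Gamma> \<turnstile> n \<Colon> NatT" and \<alpha>_has: "\<Gamma> \<turnstile> \<alpha> \<Colon> SeqT"
  shows "\<Gamma> \<tturnstile> D n \<alpha>"
proof -
  let ?C = "PiT SeqT (D (Var 1) (Var 0))"
  note ctx = has_ctx[OF n_has]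
  have C_type: "is_type (NatT # \<Gamma>) ?C"
    using ctx by (simp add: D_type)
  have "\<Gamma> \<tturnstile> inst1 ?C Zero"
    using ctx by (simp add: sub_D Zero inhabited_PiI)
  moreover have "?C # NatT # \<Gamma> \<tturnstile> sub (Succ (Var 1) \<bullet> (\<lambda>k. Var (k + 2))) ?C"
  proof -
    let ?\<Delta> = "SeqT # ?C # NatT # \<Gamma>"
    have vars_has: "?\<Delta> \<turnstile> Var 2 \<Colon> NatT" "?\<Delta> \<turnstile> Var 0 \<Colon> SeqT"
      using C_type by (simp_all add: has_Var)
    have "?\<Delta> \<tturnstile> wk (wk ?C)"
      using inhabited_second[of ?C "NatT # \<Gamma>" SeqT] C_type by simp
    then have "?\<Delta> \<tturnstile> PiT SeqT (D (Var 3) (Var 0))"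
      by (simp add: ren_eq_sub sub_D numeral_3_eq_3)
    from inhabited_PiE[OF this has_shift[OF vars_has(2)]] have "?\<Delta> \<tturnstile> D (Var 2) (shift (Var 0))"
      by (simp add: sub_D)
    with vars_has have "?\<Delta> \<tturnstile> D (Succ (Var 2)) (Var 0)"
      by (intro Succ)
    then show ?thesis
      by (simp add: sub_D inhabited_PiI numeral_2_eq_2)
  qed
  ultimately have "\<Gamma> \<tturnstile> inst1 ?C n"
    using inhabited_Nat_induct[OF C_type _ _ n_has] by blast
  then have "\<Gamma> \<tturnstile> PiT SeqT (D (wk n) (Var 0))"
    by (simp add: sub_D)
  from inhabited_PiE[OF this \<alpha>_has] show ?thesis
    by (simp add: sub_D)
qed

lemma inhabited_shift_induct_all:
  assumes sub_D: "\<And>\<sigma> n m \<alpha>. sub \<sigma> (D n m \<alpha>) = D (sub \<sigma> n) (sub \<sigma> m) (sub \<sigma> \<alpha>)"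
    and D_type: "\<And>\<Gamma> n m \<alpha>. \<Gamma> \<turnstile> n \<Colon> NatT \<Longrightarrow> \<Gamma> \<turnstile> m \<Colon> NatT \<Longrightarrow> \<Gamma> \<turnstile> \<alpha> \<Colon> SeqT \<Longrightarrow> is_type \<Gamma> (D n m \<alpha>)"
    and Zero: "\<And>\<Gamma> m \<alpha>. \<Gamma> \<turnstile> m \<Colon> NatT \<Longrightarrow> \<Gamma> \<turnstile> \<alpha> \<Colon> SeqT \<Longrightarrow> \<Gamma> \<tturnstile> D Zero m \<alpha>"
    and Succ: "\<And>\<Gamma> n m \<alpha>. \<Gamma> \<turnstile> n \<Colon> NatT \<Longrightarrow> \<Gamma> \<turnstile> m \<Colon> NatT \<Longrightarrow> \<Gamma> \<turnstile> \<alpha> \<Colon> SeqT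
      \<Longrightarrow> NatT # \<Gamma> \<tturnstile> D (wk n) (Var 0) (shift (wk \<alpha>)) \<Longrightarrow> \<Gamma> \<tturnstile> D (Succ n) m \<alpha>"
    and n_has: "\<Gamma> \<turnstile> n \<Colon> NatT" and m_has: "\<Gamma> \<turnstile> m \<Colon> NatT" and \<alpha>_has: "\<Gamma> \<turnstile> \<alpha> \<Colon> SeqT"
  shows "\<Gamma> \<tturnstile> D n m \<alpha>"
proof -
  let ?D = "\<lambda>n \<alpha>. PiT NatT (D (wk n) (Var 0) (wk \<alpha>))"
  have ren_D: "ren \<rho> (D n m \<alpha>) = D (ren \<rho> n) (ren \<rho> m) (ren \<rho> \<alpha>)" for \<rho> n m \<alpha>
    by (simp add: ren_eq_sub sub_D)
  have "\<Gamma> \<tturnstile> ?D n \<alpha>"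
  proof (rule inhabited_shift_induct[of ?D])
    fix \<Gamma> n \<alpha> assume "\<Gamma> \<turnstile> n \<Colon> NatT" and "\<Gamma> \<turnstile> \<alpha> \<Colon> SeqT"
    then show "is_type \<Gamma> (?D n \<alpha>)"
      using has_ctx[of \<Gamma> n] by (simp add: D_type)
  next
    fix \<Gamma> \<alpha> assume "\<Gamma> \<turnstile> \<alpha> \<Colon> SeqT"
    then show "\<Gamma> \<tturnstile> ?D Zero \<alpha>"
      using has_ctx[of \<Gamma> \<alpha>] by (simp add: inhabited_PiI Zero)
  next
    fix \<Gamma> n \<alpha> assume n_has: "\<Gamma> \<turnstile> n \<Colon> NatT" and \<alpha>_has: "\<Gamma> \<turnstile> \<alpha> \<Colon> SeqT" and IH: "\<Gamma> \<tturnstile> ?D n (shift \<alpha>)"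
    have Nat_type: "is_type \<Gamma> NatT"
      using has_ctx[OF n_has] by simp
    have "NatT # \<Gamma> \<tturnstile> wk (?D n (shift \<alpha>))"
      using IH Nat_type by (rule weaken_inhabited)
    then have "NatT # NatT # \<Gamma> \<tturnstile> D (wk (wk n)) (Var 0) (shift (wk (wk \<alpha>)))"
      using inhabited_PiD[of "NatT # \<Gamma>" NatT] Nat_type by (simp add: ren_D)
    then show "\<Gamma> \<tturnstile> ?D (Succ n) \<alpha>"
      using n_has \<alpha>_has Nat_type by (simp add: inhabited_PiI Succ)
  qed (use n_has \<alpha>_has in \<open>simp_all add: sub_D\<close>)
  from inhabited_PiE[OF this m_has] show ?thesis
    by (simp add: sub_D)
qed

lemma inhabited_shift_double_induct:
  assumes sub_D: "\<And>\<sigma> n m \<alpha>. sub \<sigma> (D n m \<alpha>) = D (sub \<sigma> n) (sub \<sigma> m) (sub \<sigma> \<alpha>)"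
    and D_type: "\<And>\<Gamma> n m \<alpha>. \<Gamma> \<turnstile> n \<Colon> NatT \<Longrightarrow> \<Gamma> \<turnstile> m \<Colon> NatT \<Longrightarrow> \<Gamma> \<turnstile> \<alpha> \<Colon> SeqT \<Longrightarrow> is_type \<Gamma> (D n m \<alpha>)"
    and Zero_Zero: "\<And>\<Gamma> \<alpha>. \<Gamma> \<turnstile> \<alpha> \<Colon> SeqT \<Longrightarrow> \<Gamma> \<tturnstile> D Zero Zero \<alpha>"
    and Zero_Succ: "\<And>\<Gamma> m \<alpha>. \<Gamma> \<turnstile> m \<Colon> NatT \<Longrightarrow> \<Gamma> \<turnstile> \<alpha> \<Colon> SeqT \<Longrightarrow> \<Gamma> \<tturnstile> D Zero (Succ m) \<alpha>"
    and Succ_Zero: "\<And>\<Gamma> n \<alpha>. \<Gamma> \<turnstile> n \<Colon> NatT \<Longrightarrow> \<Gamma> \<turnstile> \<alpha> \<Colon> SeqT \<Longrightarrow> \<Gamma> \<tturnstile> D (Succ n) Zero \<alpha>"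
    and Succ_Succ: "\<And>\<Gamma> n m \<alpha>. \<Gamma> \<turnstile> n \<Colon> NatT \<Longrightarrow> \<Gamma> \<turnstile> m \<Colon> NatT \<Longrightarrow> \<Gamma> \<turnstile> \<alpha> \<Colon> SeqT
      \<Longrightarrow> \<Gamma> \<tturnstile> D n m (shift \<alpha>) \<Longrightarrow> \<Gamma> \<tturnstile> D (Succ n) (Succ m) \<alpha>"
    and n_has: "\<Gamma> \<turnstile> n \<Colon> NatT" and m_has: "\<Gamma> \<turnstile> m \<Colon> NatT" and \<alpha>_has: "\<Gamma> \<turnstile> \<alpha> \<Colon> SeqT"
  shows "\<Gamma> \<tturnstile> D n m \<alpha>"
proof (rule inhabited_shift_induct_all[of D, OF sub_D D_type _ _ n_has m_has \<alpha>_has])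
  fix \<Gamma> m \<alpha> assume "\<Gamma> \<turnstile> m \<Colon> NatT" and "\<Gamma> \<turnstile> \<alpha> \<Colon> SeqT"
  then show "\<Gamma> \<tturnstile> D Zero m \<alpha>"
    using inhabited_Nat_cases[of \<Gamma> "D Zero (Var 0) (wk \<alpha>)" m] has_ctx[of \<Gamma> m]
    by (simp add: sub_D sub_Var_Suc D_type Zero_Zero Zero_Succ)
next
  fix \<Gamma> n m \<alpha> assume n_has: "\<Gamma> \<turnstile> n \<Colon> NatT" and m_has: "\<Gamma> \<turnstile> m \<Colon> NatT" and \<alpha>_has: "\<Gamma> \<turnstile> \<alpha> \<Colon> SeqT"
    and "NatT # \<Gamma> \<tturnstile> D (wk n) (Var 0) (shift (wk \<alpha>))"
  then have "NatT # \<Gamma> \<tturnstile> D (Succ (wk n)) (Succ (Var 0)) (wk \<alpha>)"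
    using has_ctx[OF n_has] by (intro Succ_Succ) simp_all
  then show "\<Gamma> \<tturnstile> D (Succ n) m \<alpha>"
    using inhabited_Nat_cases[of \<Gamma> "D (wk (Succ n)) (Var 0) (wk \<alpha>)" m] n_has m_has \<alpha>_has
      has_ctx[OF n_has] by (simp add: sub_D sub_Var_Suc D_type Succ_Zero)
qed

subsection \<open>Soundness, completeness and uniqueness\<close>

lemma inhabited_first_sound:
  assumes "\<Gamma> \<turnstile> n \<Colon> NatT" and "\<Gamma> \<turnstile> \<alpha> \<Colon> SeqT"
  shows "\<Gamma> \<tturnstile> isOne (first \<alpha>) n \<rightarrow>\<^sub>t isOne \<alpha> n"
proof (rule inhabited_shift_induct[of "\<lambda>n \<alpha>. isOne (first \<alpha>) n \<rightarrow>\<^sub>t isOne \<alpha> n", OF _ _ _ _ assms])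
  fix \<Gamma> \<alpha> assume \<alpha>_has: "\<Gamma> \<turnstile> \<alpha> \<Colon> SeqT"
  then show "\<Gamma> \<tturnstile> isOne (first \<alpha>) Zero \<rightarrow>\<^sub>t isOne \<alpha> Zero"
    using inhabited_head[of \<Gamma> "isOne (first \<alpha>) Zero"] has_ctx[OF \<alpha>_has]
    by (intro inhabited_ArrI) (simp add: inhabited_isOne_first_Zero_iff)
next
  fix \<Gamma> n \<alpha> assume n_has: "\<Gamma> \<turnstile> n \<Colon> NatT" and \<alpha>_has: "\<Gamma> \<turnstile> \<alpha> \<Colon> SeqT"
    and IH: "\<Gamma> \<tturnstile> isOne (first (shift \<alpha>)) n \<rightarrow>\<^sub>t isOne (shift \<alpha>) n"
  let ?\<Delta> = "isOne (first \<alpha>) (Succ n) # \<Gamma>"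
  have hyp_type: "is_type \<Gamma> (isOne (first \<alpha>) (Succ n))"
    using n_has \<alpha>_has by simp
  have "?\<Delta> \<tturnstile> isOne (first (shift (wk \<alpha>))) (wk n)"
    using inhabited_isOne_first_SuccD[of ?\<Delta> "wk \<alpha>" "wk n"] inhabited_head[OF hyp_type]
      n_has \<alpha>_has by simp
  moreover have "?\<Delta> \<tturnstile> isOne (first (shift (wk \<alpha>))) (wk n) \<rightarrow>\<^sub>t isOne (shift (wk \<alpha>)) (wk n)"
    using weaken_inhabited[OF IH hyp_type] by simp
  ultimately have "?\<Delta> \<tturnstile> isOne (shift (wk \<alpha>)) (wk n)"
    using inhabited_ArrE by blast
  then show "\<Gamma> \<tturnstile> isOne (first \<alpha>) (Succ n) \<rightarrow>\<^sub>t isOne \<alpha> (Succ n)"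
    using n_has \<alpha>_has by (intro inhabited_ArrI) (simp add: inhabited_isOne_shift_iff)
qed simp_all

lemma inhabited_first_complete_Succ:
  assumes "\<Gamma> \<tturnstile> isOne (first (shift \<alpha>)) n" and \<alpha>_has: "\<Gamma> \<turnstile> \<alpha> \<Colon> SeqT" and n_has: "\<Gamma> \<turnstile> n \<Colon> NatT"
  shows "\<Gamma> \<tturnstile> angle (first \<alpha>)"
proof (rule inhabited_bit_cases)
  note ctx = has_ctx[OF n_has]
  show App_has: "\<Gamma> \<turnstile> App \<alpha> Zero \<Colon> TwoT" and "is_type \<Gamma> (angle (first \<alpha>))"
    using \<alpha>_has ctx by simp_all
  let ?\<Delta> = "fails (App \<alpha> Zero) # \<Gamma>"
  have "?\<Delta> \<tturnstile> holds (App (first (shift (wk \<alpha>))) (wk n))"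
    using weaken_inhabited[OF assms(1), of "fails (App \<alpha> Zero)"] App_has ctx by (simp add: isOne_def)
  then have "?\<Delta> \<tturnstile> holds (and_not (App (first (shift (wk \<alpha>))) (wk n)) (App (wk \<alpha>) Zero))"
    using inhabited_holds_and_notI[of ?\<Delta> "App (first (shift (wk \<alpha>))) (wk n)" "App (wk \<alpha>) Zero"]
      inhabited_head[of \<Gamma> "fails (App \<alpha> Zero)"] App_has \<alpha>_has n_has ctx by simp
  then have "?\<Delta> \<tturnstile> isOne (first (wk \<alpha>)) (Succ (wk n))"
    using App_has \<alpha>_has n_has ctx by (simp add: inhabited_isOne_first_Succ_iff)
  then show "?\<Delta> \<tturnstile> wk (angle (first \<alpha>))"
    using inhabited_angleI[of ?\<Delta> "first (wk \<alpha>)" "Succ (wk n)"] App_has \<alpha>_has n_has ctx by simp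
  let ?\<Delta>' = "holds (App \<alpha> Zero) # \<Gamma>"
  have "?\<Delta>' \<tturnstile> isOne (wk \<alpha>) Zero"
    using inhabited_head[of \<Gamma> "holds (App \<alpha> Zero)"] App_has by (simp add: isOne_def)
  then have "?\<Delta>' \<tturnstile> isOne (first (wk \<alpha>)) Zero"
    using App_has \<alpha>_has by (simp add: inhabited_isOne_first_Zero_iff)
  then show "?\<Delta>' \<tturnstile> wk (angle (first \<alpha>))"
    using inhabited_angleI[of ?\<Delta>' "first (wk \<alpha>)" Zero] App_has \<alpha>_has by simp
qed

lemma inhabited_first_complete:
  assumes "\<Gamma> \<turnstile> n \<Colon> NatT" and "\<Gamma> \<turnstile> \<alpha> \<Colon> SeqT"
  shows "\<Gamma> \<tturnstile> isOne \<alpha> n \<rightarrow>\<^sub>t angle (first \<alpha>)"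
proof (rule inhabited_shift_induct[of "\<lambda>n \<alpha>. isOne \<alpha> n \<rightarrow>\<^sub>t angle (first \<alpha>)", OF _ _ _ _ assms])
  fix \<Gamma> \<alpha> assume \<alpha>_has: "\<Gamma> \<turnstile> \<alpha> \<Colon> SeqT"
  let ?\<Delta> = "isOne \<alpha> Zero # \<Gamma>"
  note ctx = has_ctx[OF \<alpha>_has]
  have "?\<Delta> \<tturnstile> isOne (first (wk \<alpha>)) Zero"
    using inhabited_head[of \<Gamma> "isOne \<alpha> Zero"] \<alpha>_has ctx by (simp add: inhabited_isOne_first_Zero_iff)
  then show "\<Gamma> \<tturnstile> isOne \<alpha> Zero \<rightarrow>\<^sub>t angle (first \<alpha>)"
    using inhabited_angleI[of ?\<Delta> "first (wk \<alpha>)" Zero] \<alpha>_has ctx by (simp add: inhabited_ArrI)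
next
  fix \<Gamma> n \<alpha> assume n_has: "\<Gamma> \<turnstile> n \<Colon> NatT" and \<alpha>_has: "\<Gamma> \<turnstile> \<alpha> \<Colon> SeqT"
    and IH: "\<Gamma> \<tturnstile> isOne (shift \<alpha>) n \<rightarrow>\<^sub>t angle (first (shift \<alpha>))"
  let ?\<Delta> = "isOne \<alpha> (Succ n) # \<Gamma>"
  have hyp_type: "is_type \<Gamma> (isOne \<alpha> (Succ n))"
    using n_has \<alpha>_has by simp
  have "?\<Delta> \<tturnstile> isOne (shift (wk \<alpha>)) (wk n)"
    using inhabited_head[OF hyp_type] n_has \<alpha>_has by (simp add: inhabited_isOne_shift_iff)
  moreover have "?\<Delta> \<tturnstile> isOne (shift (wk \<alpha>)) (wk n) \<rightarrow>\<^sub>t angle (first (shift (wk \<alpha>)))"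
    using weaken_inhabited[OF IH hyp_type] by simp
  ultimately have "?\<Delta> \<tturnstile> angle (first (shift (wk \<alpha>)))"
    using inhabited_ArrE by blast
  then obtain m where "?\<Delta> \<turnstile> m \<Colon> NatT" and "?\<Delta> \<tturnstile> isOne (first (shift (wk \<alpha>))) m"
    by (rule inhabited_angleE)
  then have "?\<Delta> \<tturnstile> angle (first (wk \<alpha>))"
    using \<alpha>_has hyp_type by (intro inhabited_first_complete_Succ) simp_all
  then show "\<Gamma> \<tturnstile> isOne \<alpha> (Succ n) \<rightarrow>\<^sub>t angle (first \<alpha>)"
    by (simp add: inhabited_ArrI)
qed simp_all

lemma inhabited_first_unique_Succ:
  assumes IH: "\<Gamma> \<tturnstile> isOne (first (shift \<alpha>)) n \<rightarrow>\<^sub>t isOne (first (shift \<alpha>)) m \<rightarrow>\<^sub>t IdT NatT n m"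
    and "\<Gamma> \<tturnstile> isOne (first \<alpha>) (Succ n)" and "\<Gamma> \<tturnstile> isOne (first \<alpha>) (Succ m)"
    and \<alpha>_has: "\<Gamma> \<turnstile> \<alpha> \<Colon> SeqT" and n_has: "\<Gamma> \<turnstile> n \<Colon> NatT" and m_has: "\<Gamma> \<turnstile> m \<Colon> NatT"
  shows "\<Gamma> \<tturnstile> IdT NatT (Succ n) (Succ m)"
proof -
  have "\<Gamma> \<tturnstile> isOne (first (shift \<alpha>)) n" and "\<Gamma> \<tturnstile> isOne (first (shift \<alpha>)) m"
    using assms(2,3) \<alpha>_has n_has m_has by (blast intro: inhabited_isOne_first_SuccD)+
  with IH have "\<Gamma> \<tturnstile> IdT NatT n m"
    using inhabited_ArrE by blast
  then show ?thesis
    using inhabited_cong[of \<Gamma> NatT n m "Succ (Var 0)" NatT] n_has m_has has_ctx[OF n_has] by simp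
qed

lemma inhabited_first_unique:
  assumes "\<Gamma> \<turnstile> n \<Colon> NatT" and "\<Gamma> \<turnstile> m \<Colon> NatT" and "\<Gamma> \<turnstile> \<alpha> \<Colon> SeqT"
  shows "\<Gamma> \<tturnstile> isOne (first \<alpha>) n \<rightarrow>\<^sub>t isOne (first \<alpha>) m \<rightarrow>\<^sub>t IdT NatT n m" (is "\<Gamma> \<tturnstile> ?D n m \<alpha>")
proof (rule inhabited_shift_double_induct[of ?D, OF _ _ _ _ _ _ assms])
  fix \<Gamma> \<alpha> assume \<alpha>_has: "\<Gamma> \<turnstile> \<alpha> \<Colon> SeqT"
  then show "\<Gamma> \<tturnstile> ?D Zero Zero \<alpha>"
    using has_ctx[OF \<alpha>_has] by (simp add: inhabited_Arr_ArrI inhabited_refl)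
next
  fix \<Gamma> m \<alpha> assume m_has: "\<Gamma> \<turnstile> m \<Colon> NatT" and \<alpha>_has: "\<Gamma> \<turnstile> \<alpha> \<Colon> SeqT"
  let ?H = "isOne (first \<alpha>) Zero" and ?K = "isOne (first (wk \<alpha>)) (Succ (wk m))"
  show "\<Gamma> \<tturnstile> ?D Zero (Succ m) \<alpha>"
    using inhabited_isOne_first_disjoint[of "?K # ?H # \<Gamma>" "wk (wk \<alpha>)" "wk (wk m)"
        "IdT NatT Zero (Succ (wk (wk m)))"]
      inhabited_head[of "?H # \<Gamma>" ?K] inhabited_second[of ?H \<Gamma> ?K] m_has \<alpha>_has has_ctx[OF \<alpha>_has]
    by (simp add: inhabited_Arr_ArrI)
next
  fix \<Gamma> n \<alpha> assume n_has: "\<Gamma> \<turnstile> n \<Colon> NatT" and \<alpha>_has: "\<Gamma> \<turnstile> \<alpha> \<Colon> SeqT"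
  let ?H = "isOne (first \<alpha>) (Succ n)" and ?K = "isOne (first (wk \<alpha>)) Zero"
  show "\<Gamma> \<tturnstile> ?D (Succ n) Zero \<alpha>"
    using inhabited_isOne_first_disjoint[of "?K # ?H # \<Gamma>" "wk (wk \<alpha>)" "wk (wk n)"
        "IdT NatT (Succ (wk (wk n))) Zero"]
      inhabited_head[of "?H # \<Gamma>" ?K] inhabited_second[of ?H \<Gamma> ?K] n_has \<alpha>_has has_ctx[OF \<alpha>_has]
    by (simp add: inhabited_Arr_ArrI)
next
  fix \<Gamma> n m \<alpha> assume n_has: "\<Gamma> \<turnstile> n \<Colon> NatT" and m_has: "\<Gamma> \<turnstile> m \<Colon> NatT" and \<alpha>_has: "\<Gamma> \<turnstile> \<alpha> \<Colon> SeqT"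
    and IH: "\<Gamma> \<tturnstile> ?D n m (shift \<alpha>)"
  let ?H = "isOne (first \<alpha>) (Succ n)" and ?K = "isOne (first (wk \<alpha>)) (Succ (wk m))"
  show "\<Gamma> \<tturnstile> ?D (Succ n) (Succ m) \<alpha>"
    using inhabited_first_unique_Succ[of "?K # ?H # \<Gamma>" "wk (wk \<alpha>)" "wk (wk n)" "wk (wk m)"]
      weaken_inhabited[OF weaken_inhabited[OF IH, of ?H], of ?K] inhabited_head[of "?H # \<Gamma>" ?K]
      inhabited_second[of ?H \<Gamma> ?K] n_has m_has \<alpha>_has by (simp add: inhabited_Arr_ArrI)
qed simp_all

lemma inhabited_at_most_one_first:
  assumes "\<Gamma> \<turnstile> \<alpha> \<Colon> SeqT"
  shows "\<Gamma> \<tturnstile> at_most_one (first \<alpha>)"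
  unfolding at_most_one_def
  using inhabited_first_unique[of "NatT # NatT # \<Gamma>" "Var 1" "Var 0" "wk (wk \<alpha>)"] assms has_ctx[OF assms]
  by (simp add: inhabited_PiI)

section \<open>The two choice principles\<close>

abbreviation pointwise_maps :: "tm \<Rightarrow> tm \<Rightarrow> tm" where
  "pointwise_maps \<alpha> A \<equiv> PiT NatT (isOne (wk \<alpha>) (Var 0) \<rightarrow>\<^sub>t wk A)"

abbreviation pointwise_Trunc_maps :: "tm \<Rightarrow> tm \<Rightarrow> tm" where
  "pointwise_Trunc_maps \<alpha> A \<equiv> PiT NatT (Trunc (isOne (wk \<alpha>) (Var 0) \<rightarrow>\<^sub>t wk A))"

lemma sequence_choice_eq: "sequence_choice A =
    PiT SeqT (pointwise_Trunc_maps (Var 0) (wk A) \<rightarrow>\<^sub>t Trunc (pointwise_maps (Var 0) (wk A)))"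
  by (simp add: sequence_choice_def)

lemma ren_sequence_choice [simp]: "ren \<rho> (sequence_choice A) = sequence_choice (ren \<rho> A)"
  by (simp add: sequence_choice_eq)

lemma ren_Rosolini_choice [simp]: "ren \<rho> (Rosolini_choice i A) = Rosolini_choice i (ren \<rho> A)"
  by (simp add: Rosolini_choice_def)

lemma is_type_sequence_choice [simp]: "is_type \<Gamma> A \<Longrightarrow> is_type \<Gamma> (sequence_choice A)"
  using is_type_ctx[of \<Gamma> A] by (simp add: sequence_choice_eq)

lemma is_type_Rosolini_choice [simp]: "is_type \<Gamma> A \<Longrightarrow> is_type \<Gamma> (Rosolini_choice i A)"
  using is_type_ctx[of \<Gamma> A] by (simp add: Rosolini_choice_def)

lemma inhabited_sequence_choiceE:
  assumes "\<Gamma> \<tturnstile> sequence_choice A" and "\<Gamma> \<turnstile> \<alpha> \<Colon> SeqT" and "\<Gamma> \<tturnstile> pointwise_Trunc_maps \<alpha> A"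
  shows "\<Gamma> \<tturnstile> Trunc (pointwise_maps \<alpha> A)"
  using inhabited_PiE[OF assms(1)[unfolded sequence_choice_eq] assms(2)] assms(3) inhabited_ArrE by simp

lemma inhabited_Rosolini_choiceE:
  assumes "\<Gamma> \<tturnstile> Rosolini_choice i A" and "\<Gamma> \<turnstile> P \<Colon> Univ i" and "\<Gamma> \<tturnstile> isProp P"
    and "\<Gamma> \<tturnstile> isRosolini i P" and "\<Gamma> \<tturnstile> P \<rightarrow>\<^sub>t Trunc A"
  shows "\<Gamma> \<tturnstile> Trunc (P \<rightarrow>\<^sub>t A)"
proof -
  have "\<Gamma> \<tturnstile> isProp P \<rightarrow>\<^sub>t isRosolini i P \<rightarrow>\<^sub>t (P \<rightarrow>\<^sub>t Trunc A) \<rightarrow>\<^sub>t Trunc (P \<rightarrow>\<^sub>t A)"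
    using inhabited_PiE[OF assms(1)[unfolded Rosolini_choice_def] assms(2)] by simp
  then show ?thesis
    using assms(3-) inhabited_ArrE by blast
qed

subsection \<open>From sequence choice to Rosolini choice\<close>

lemma inhabited_pointwise_Trunc_maps:
  assumes "\<Gamma> \<tturnstile> angle \<alpha> \<rightarrow>\<^sub>t Trunc A" and \<alpha>_has: "\<Gamma> \<turnstile> \<alpha> \<Colon> SeqT" and A_type: "is_type \<Gamma> A"
  shows "\<Gamma> \<tturnstile> pointwise_Trunc_maps \<alpha> A"
proof (rule inhabited_PiI)
  note ctx = has_ctx[OF \<alpha>_has]
  let ?b = "App (wk \<alpha>) (Var 0)"
  let ?\<Delta> = "holds ?b # NatT # \<Gamma>"
  have b_has: "NatT # \<Gamma> \<turnstile> ?b \<Colon> TwoT"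
    using \<alpha>_has ctx by simp
  have "?\<Delta> \<tturnstile> isOne (wk (wk \<alpha>)) (Var 1)"
    using inhabited_head[of "NatT # \<Gamma>" "holds ?b"] b_has by (simp add: isOne_def)
  then have "?\<Delta> \<tturnstile> angle (wk (wk \<alpha>))"
    using \<alpha>_has b_has ctx by (intro inhabited_angleI[where n = "Var 1"]) simp_all
  moreover have "?\<Delta> \<tturnstile> angle (wk (wk \<alpha>)) \<rightarrow>\<^sub>t Trunc (wk (wk A))"
    using weaken_inhabited[OF weaken_inhabited[OF assms(1)]] b_has ctx by simp
  ultimately have "?\<Delta> \<tturnstile> Trunc (wk (wk A))"
    by (rule inhabited_ArrE[rotated])
  then show "NatT # \<Gamma> \<tturnstile> Trunc (isOne (wk \<alpha>) (Var 0) \<rightarrow>\<^sub>t wk A)"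
    unfolding isOne_def using b_has A_type ctx by (intro inhabited_Trunc_holds_Arr) simp_all
qed

lemma inhabited_angle_Arr:
  assumes "\<Gamma> \<tturnstile> pointwise_maps \<alpha> A" and "\<Gamma> \<turnstile> \<alpha> \<Colon> SeqT"
  shows "\<Gamma> \<tturnstile> angle \<alpha> \<rightarrow>\<^sub>t A"
proof (rule inhabited_ArrI)
  have angle_type: "is_type \<Gamma> (angle \<alpha>)"
    using assms(2) by simp
  have "angle \<alpha> # \<Gamma> \<tturnstile> angle (wk \<alpha>)"
    using inhabited_head[OF angle_type] by simp
  then obtain n where n_has: "angle \<alpha> # \<Gamma> \<turnstile> n \<Colon> NatT" and "angle \<alpha> # \<Gamma> \<tturnstile> isOne (wk \<alpha>) n"
    by (rule inhabited_angleE)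
  moreover have "angle \<alpha> # \<Gamma> \<tturnstile> isOne (wk \<alpha>) n \<rightarrow>\<^sub>t wk A"
    using weaken_inhabited[OF assms(1) angle_type] inhabited_PiE[OF _ n_has] by fastforce
  ultimately show "angle \<alpha> # \<Gamma> \<tturnstile> wk A"
    using inhabited_ArrE by blast
qed

lemma inhabited_angle_choice:
  assumes "\<Gamma> \<tturnstile> sequence_choice A" and "\<Gamma> \<tturnstile> angle \<alpha> \<rightarrow>\<^sub>t Trunc A"
    and \<alpha>_has: "\<Gamma> \<turnstile> \<alpha> \<Colon> SeqT" and A_type: "is_type \<Gamma> A"
  shows "\<Gamma> \<tturnstile> Trunc (angle \<alpha> \<rightarrow>\<^sub>t A)"
proof (rule inhabited_Trunc_map)
  show "\<Gamma> \<tturnstile> Trunc (pointwise_maps \<alpha> A)"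
    using assms(1) \<alpha>_has inhabited_pointwise_Trunc_maps[OF assms(2) \<alpha>_has A_type]
    by (rule inhabited_sequence_choiceE)
  have maps_type: "is_type \<Gamma> (pointwise_maps \<alpha> A)"
    using \<alpha>_has A_type has_ctx[OF \<alpha>_has] by simp
  show "pointwise_maps \<alpha> A # \<Gamma> \<tturnstile> wk (angle \<alpha> \<rightarrow>\<^sub>t A)"
    using inhabited_angle_Arr[of "pointwise_maps \<alpha> A # \<Gamma>" "wk \<alpha>" "wk A"] inhabited_head[OF maps_type]
      maps_type \<alpha>_has by simp
  show "is_type \<Gamma> (angle \<alpha> \<rightarrow>\<^sub>t A)"
    using \<alpha>_has A_type by simp
qed

text \<open>The statement about \<open>P\<close> is the statement about \<open>\<langle>\<alpha>\<rangle>\<close> transported along \<open>P = \<langle>\<alpha>\<rangle>\<close>.\<close>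

lemma inhabited_Rosolini_structure_choice:
  assumes "\<Gamma> \<tturnstile> Rosolini_structure i P" and "\<Gamma> \<tturnstile> sequence_choice A" and "\<Gamma> \<tturnstile> P \<rightarrow>\<^sub>t Trunc A"
    and P_has: "\<Gamma> \<turnstile> P \<Colon> Univ i" and A_type: "is_type \<Gamma> A"
  shows "\<Gamma> \<tturnstile> Trunc (P \<rightarrow>\<^sub>t A)"
proof -
  note ctx = has_ctx[OF P_has]
  let ?C = "(Var 0 \<rightarrow>\<^sub>t Trunc (wk A)) \<rightarrow>\<^sub>t Trunc (Var 0 \<rightarrow>\<^sub>t wk A)"
  obtain \<alpha> where \<alpha>_has: "\<Gamma> \<turnstile> \<alpha> \<Colon> SeqT" and "\<Gamma> \<tturnstile> IdT (Univ i) P (angle \<alpha>)"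
    using assms(1) by (rule inhabited_Rosolini_structureE)
  then have path: "\<Gamma> \<tturnstile> IdT (Univ i) (angle \<alpha>) P"
    using P_has ctx by (elim inhabited_sym) (simp_all add: angle_has)
  have hyp_type: "is_type \<Gamma> (angle \<alpha> \<rightarrow>\<^sub>t Trunc A)"
    using \<alpha>_has A_type by simp
  have "\<Gamma> \<tturnstile> (angle \<alpha> \<rightarrow>\<^sub>t Trunc A) \<rightarrow>\<^sub>t Trunc (angle \<alpha> \<rightarrow>\<^sub>t A)"
    using inhabited_angle_choice[of _ "wk A" "wk \<alpha>"] inhabited_head[OF hyp_type]
      weaken_inhabited[OF assms(2) hyp_type] hyp_type \<alpha>_has A_type by (intro inhabited_ArrI) simp
  moreover have "is_type (Univ i # \<Gamma>) ?C"
    using A_type ctx by simp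
  ultimately have "\<Gamma> \<tturnstile> (P \<rightarrow>\<^sub>t Trunc A) \<rightarrow>\<^sub>t Trunc (P \<rightarrow>\<^sub>t A)"
    using inhabited_transport[OF path angle_has[OF \<alpha>_has] P_has, of ?C] by simp
  then show ?thesis
    using assms(3) by (rule inhabited_ArrE)
qed

lemma inhabited_isRosolini_choice:
  assumes "\<Gamma> \<tturnstile> isRosolini i P" and "\<Gamma> \<tturnstile> sequence_choice A" and "\<Gamma> \<tturnstile> P \<rightarrow>\<^sub>t Trunc A"
    and P_has: "\<Gamma> \<turnstile> P \<Colon> Univ i" and A_type: "is_type \<Gamma> A"
  shows "\<Gamma> \<tturnstile> Trunc (P \<rightarrow>\<^sub>t A)"
proof (rule inhabited_Trunc_bind)
  show "\<Gamma> \<tturnstile> Trunc (Rosolini_structure i P)"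
    using assms(1) by (simp add: isRosolini_eq_Trunc)
  let ?\<Delta> = "Rosolini_structure i P # \<Gamma>"
  have hyp_type: "is_type \<Gamma> (Rosolini_structure i P)"
    using P_has by simp
  show "?\<Delta> \<tturnstile> Trunc (wk (P \<rightarrow>\<^sub>t A))"
    using inhabited_Rosolini_structure_choice[of ?\<Delta> i "wk P" "wk A"] inhabited_head[OF hyp_type]
      weaken_inhabited[OF assms(2) hyp_type] weaken_inhabited[OF assms(3) hyp_type]
      P_has A_type hyp_type by simp
  show "is_type \<Gamma> (P \<rightarrow>\<^sub>t A)"
    using has_Univ_is_type[OF P_has] A_type by simp
qed

lemma inhabited_isRosolini_Arr_choice:
  assumes "\<Gamma> \<tturnstile> sequence_choice A" and P_has: "\<Gamma> \<turnstile> P \<Colon> Univ i" and A_type: "is_type \<Gamma> A"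
  shows "\<Gamma> \<tturnstile> isRosolini i P \<rightarrow>\<^sub>t (P \<rightarrow>\<^sub>t Trunc A) \<rightarrow>\<^sub>t Trunc (P \<rightarrow>\<^sub>t A)"
proof (rule inhabited_Arr_ArrI)
  let ?R = "isRosolini i P" and ?H = "P \<rightarrow>\<^sub>t Trunc A"
  let ?\<Delta> = "wk ?H # ?R # \<Gamma>"
  have R_type: "is_type \<Gamma> ?R" and "is_type \<Gamma> ?H"
    using P_has A_type has_Univ_is_type[OF P_has] by simp_all
  then have H_type: "is_type (?R # \<Gamma>) (wk ?H)"
    by (intro weaken_is_type)
  have "?\<Delta> \<tturnstile> sequence_choice (wk (wk A))"
    using weaken_inhabited[OF weaken_inhabited[OF assms(1) R_type] H_type] by simp
  moreover have "?\<Delta> \<turnstile> wk (wk P) \<Colon> Univ i"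
    using weaken_has_Univ[OF weaken_has_Univ[OF P_has R_type] H_type] .
  moreover have "is_type ?\<Delta> (wk (wk A))"
    using weaken_is_type[OF weaken_is_type[OF A_type R_type] H_type] .
  ultimately show "?\<Delta> \<tturnstile> wk (wk (Trunc (P \<rightarrow>\<^sub>t A)))"
    using inhabited_isRosolini_choice[of ?\<Delta> i "wk (wk P)" "wk (wk A)"]
      inhabited_second[OF H_type] inhabited_head[OF H_type] by simp
qed

lemma inhabited_Rosolini_choiceI:
  assumes "\<Gamma> \<tturnstile> sequence_choice A" and A_type: "is_type \<Gamma> A"
  shows "\<Gamma> \<tturnstile> Rosolini_choice i A"
  unfolding Rosolini_choice_def
proof (intro inhabited_PiI inhabited_Arr_const[of _ _ "isProp (Var 0)"])
  have Univ_type: "is_type \<Gamma> (Univ i)"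
    using is_type_ctx[OF A_type] by simp
  then show "Univ i # \<Gamma> \<tturnstile> isRosolini i (Var 0)
      \<rightarrow>\<^sub>t (Var 0 \<rightarrow>\<^sub>t Trunc (wk A)) \<rightarrow>\<^sub>t Trunc (Var 0 \<rightarrow>\<^sub>t wk A)"
    using inhabited_isRosolini_Arr_choice[of "Univ i # \<Gamma>" "wk A" "Var 0" i]
      weaken_inhabited[OF assms(1)] A_type by simp
  show "is_type (Univ i # \<Gamma>) (isProp (Var 0))"
    using is_type_ctx[OF A_type] by simp
qed

lemma inhabited_sequence_choice_Arr_Rosolini_choice:
  assumes "is_type \<Gamma> A"
  shows "\<Gamma> \<tturnstile> sequence_choice A \<rightarrow>\<^sub>t Rosolini_choice i A"
  using inhabited_Rosolini_choiceI[of "sequence_choice A # \<Gamma>" "wk A"]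
    inhabited_head[of \<Gamma> "sequence_choice A"] assms by (simp add: inhabited_ArrI)

subsection \<open>From Rosolini choice to sequence choice\<close>

lemma inhabited_angle_first_Arr_Trunc:
  assumes "\<Gamma> \<tturnstile> pointwise_Trunc_maps \<alpha> A" and \<alpha>_has: "\<Gamma> \<turnstile> \<alpha> \<Colon> SeqT" and A_type: "is_type \<Gamma> A"
  shows "\<Gamma> \<tturnstile> angle (first \<alpha>) \<rightarrow>\<^sub>t Trunc A"
proof (rule inhabited_ArrI)
  let ?\<Delta> = "angle (first \<alpha>) # \<Gamma>"
  have angle_type: "is_type \<Gamma> (angle (first \<alpha>))"
    using \<alpha>_has by simp
  then have wk_\<alpha>_has: "?\<Delta> \<turnstile> wk \<alpha> \<Colon> SeqT"
    using \<alpha>_has by simp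
  have "?\<Delta> \<tturnstile> angle (first (wk \<alpha>))"
    using inhabited_head[OF angle_type] by simp
  then obtain n where n_has: "?\<Delta> \<turnstile> n \<Colon> NatT" and "?\<Delta> \<tturnstile> isOne (first (wk \<alpha>)) n"
    by (rule inhabited_angleE)
  then have "?\<Delta> \<tturnstile> isOne (wk \<alpha>) n"
    using inhabited_first_sound[OF n_has wk_\<alpha>_has] inhabited_ArrE by blast
  moreover have "?\<Delta> \<tturnstile> Trunc (isOne (wk \<alpha>) n \<rightarrow>\<^sub>t wk A)"
    using inhabited_PiE[OF _ n_has] weaken_inhabited[OF assms(1) angle_type] by fastforce
  ultimately show "?\<Delta> \<tturnstile> wk (Trunc A)"
    using inhabited_Trunc_ArrE[of ?\<Delta> "isOne (wk \<alpha>) n" "wk A"] n_has wk_\<alpha>_has A_type angle_type by simp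
qed

lemma inhabited_pointwise_maps_of_first:
  assumes "\<Gamma> \<tturnstile> angle (first \<alpha>) \<rightarrow>\<^sub>t A" and \<alpha>_has: "\<Gamma> \<turnstile> \<alpha> \<Colon> SeqT"
  shows "\<Gamma> \<tturnstile> pointwise_maps \<alpha> A"
proof (rule inhabited_PiI)
  have Nat_type: "is_type \<Gamma> NatT"
    using has_ctx[OF \<alpha>_has] by simp
  have "NatT # \<Gamma> \<tturnstile> isOne (wk \<alpha>) (Var 0) \<rightarrow>\<^sub>t angle (first (wk \<alpha>))"
    using \<alpha>_has Nat_type by (intro inhabited_first_complete) simp_all
  moreover have "NatT # \<Gamma> \<tturnstile> angle (first (wk \<alpha>)) \<rightarrow>\<^sub>t wk A"
    using weaken_inhabited[OF assms(1) Nat_type] by simp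
  ultimately show "NatT # \<Gamma> \<tturnstile> isOne (wk \<alpha>) (Var 0) \<rightarrow>\<^sub>t wk A"
    using inhabited_Arr_trans \<alpha>_has Nat_type by simp
qed

lemma inhabited_Trunc_pointwise_maps:
  assumes "\<Gamma> \<tturnstile> Rosolini_choice i A" and "\<Gamma> \<tturnstile> pointwise_Trunc_maps \<alpha> A"
    and \<alpha>_has: "\<Gamma> \<turnstile> \<alpha> \<Colon> SeqT" and A_type: "is_type \<Gamma> A"
  shows "\<Gamma> \<tturnstile> Trunc (pointwise_maps \<alpha> A)"
proof (rule inhabited_Trunc_map)
  let ?\<beta> = "first \<alpha>"
  have \<beta>_has: "\<Gamma> \<turnstile> ?\<beta> \<Colon> SeqT" and \<beta>_prop: "\<Gamma> \<tturnstile> isProp (angle ?\<beta>)"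
    using \<alpha>_has by (simp_all add: inhabited_isProp_angle inhabited_at_most_one_first)
  show "\<Gamma> \<tturnstile> Trunc (angle ?\<beta> \<rightarrow>\<^sub>t A)"
    using assms(1) angle_has[OF \<beta>_has] \<beta>_prop inhabited_isRosolini_angle[OF \<beta>_has \<beta>_prop]
      inhabited_angle_first_Arr_Trunc[OF assms(2) \<alpha>_has A_type] by (rule inhabited_Rosolini_choiceE)
  have Arr_type: "is_type \<Gamma> (angle ?\<beta> \<rightarrow>\<^sub>t A)"
    using \<beta>_has A_type by simp
  then show "(angle ?\<beta> \<rightarrow>\<^sub>t A) # \<Gamma> \<tturnstile> wk (pointwise_maps \<alpha> A)"
    using inhabited_pointwise_maps_of_first[of "(angle ?\<beta> \<rightarrow>\<^sub>t A) # \<Gamma>" "wk \<alpha>" "wk A"]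
      inhabited_head[OF Arr_type] \<alpha>_has by simp
  show "is_type \<Gamma> (pointwise_maps \<alpha> A)"
    using \<alpha>_has A_type has_ctx[OF \<alpha>_has] by simp
qed

lemma inhabited_sequence_choiceI:
  assumes "\<Gamma> \<tturnstile> Rosolini_choice i A" and A_type: "is_type \<Gamma> A"
  shows "\<Gamma> \<tturnstile> sequence_choice A"
  unfolding sequence_choice_eq
proof (intro inhabited_PiI inhabited_ArrI)
  let ?H = "pointwise_Trunc_maps (Var 0) (wk A)"
  have Seq_type: "is_type \<Gamma> SeqT" and H_type: "is_type (SeqT # \<Gamma>) ?H"
    using is_type_ctx[OF A_type] A_type by simp_all
  show "?H # SeqT # \<Gamma> \<tturnstile> wk (Trunc (pointwise_maps (Var 0) (wk A)))"
    using inhabited_Trunc_pointwise_maps[of "?H # SeqT # \<Gamma>" i "wk (wk A)" "Var 1"]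
      inhabited_head[OF H_type] weaken_inhabited[OF weaken_inhabited[OF assms(1) Seq_type] H_type]
      Seq_type H_type A_type by simp
qed

lemma inhabited_Rosolini_choice_Arr_sequence_choice:
  assumes "is_type \<Gamma> A"
  shows "\<Gamma> \<tturnstile> Rosolini_choice i A \<rightarrow>\<^sub>t sequence_choice A"
  using inhabited_sequence_choiceI[of "Rosolini_choice i A # \<Gamma>" i "wk A"]
    inhabited_head[of \<Gamma> "Rosolini_choice i A"] assms by (simp add: inhabited_ArrI)

theorem theorem5p29:
  fixes i :: nat
  shows "\<exists>t. [] \<turnstile> t \<Colon> PiT (Univ i) (sequence_choice (Var 0) \<leftrightarrow>\<^sub>t Rosolini_choice i (Var 0))"
proof -
  have "is_type [Univ i] (Var 0)"
    using ctx_Nil by (rule is_type_Var_Univ)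
  then have "[Univ i] \<tturnstile> sequence_choice (Var 0) \<leftrightarrow>\<^sub>t Rosolini_choice i (Var 0)"
    by (simp add: inhabited_IffI inhabited_sequence_choice_Arr_Rosolini_choice
        inhabited_Rosolini_choice_Arr_sequence_choice)
  then have "[] \<tturnstile> PiT (Univ i) (sequence_choice (Var 0) \<leftrightarrow>\<^sub>t Rosolini_choice i (Var 0))"
    by (rule inhabited_PiI)
  then show ?thesis
    by (simp add: inhabited_def)
qed

end
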